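(* There is an effective transformation which maps every monodic first-order temporal formula $\phi$ to a monodic temporal problem $\mathsf P=\langle\mathcal U,\mathcal I,\mathcal S,\mathcal E\rangle$ in Divided Separated Normal Form such that $\phi$ is satisfiable if and only if $\mathsf P$ is satisfiable, and such that the size of $\mathsf P$ is at most linear in the size of $\phi$.
   Context: First-order temporal language: predicate symbols of fixed arity (0-ary ones are propositions), individual variables, individual constants, Boolean operators (including true and false), quantifiers, and temporal operators $\bigcirc$ (next), $\Diamond$ (sometime), $\Box$ (always), $\mathrm U$ (until), $\mathrm W$ (weak until). There are no function symbols and no equality. Semantics (constant domains). A temporal structure is $\mathfrak M=\langle D,I\rangle$ with $D\neq\emptyset$ and, for each $n\in\mathbb N$, a first-order structure $\mathfrak M_n=\langle D,I_n\rangle$; constants are rigid ($I_i(c)=I_j(c)$ for all $i,j$), predicates are flexible. For an assignment $\mathfrak a$ of variables to elements of $D$, first-order connectives are interpreted in $\mathfrak M_n$ as usual, and: $\mathfrak M_n\models^{\mathfrak a}\bigcirc\phi$ iff $\mathfrak M_{n+1}\models^{\mathfrak a}\phi$; $\mathfrak M_n\models^{\mathfrak a}\Diamond\phi$ iff $\mathfrak M_m\models^{\mathfrak a}\phi$ for some $m\ge n$; $\mathfrak M_n\models^{\mathfrak a}\Box\phi$ iff $\mathfrak M_m\models^{\mathfrak a}\phi$ for all $m\ge n$; $\mathfrak M_n\models^{\mathfrak a}\phi\,\mathrm U\,\psi$ iff there is $m\ge n$ with $\mathfrak M_m\models^{\mathfrak a}\psi$ and $\mathfrak M_i\models^{\mathfrak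 a}\phi$ for all $n\le i<m$; $\mathfrak M_n\models^{\mathfrak a}\phi\,\mathrm W\,\psi$ iff $\mathfrak M_n\models^{\mathfrak a}\phi\,\mathrm U\,\psi$ or $\mathfrak M_n\models^{\mathfrak a}\Box\phi$. A formula $\phi$ is satisfiable if $\mathfrak M_0\models^{\mathfrak a}\phi$ for some $\mathfrak M$ and $\mathfrak a$. A formula is monodic if every subformula whose main connective is a temporal operator has at most one free variable. A monodic temporal problem in Divided Separated Normal Form (DSNF) is a quadruple $\langle\mathcal U,\mathcal I,\mathcal S,\mathcal E\rangle$ where: $\mathcal U$ (universal part) and $\mathcal I$ (initial part) are finite sets of closed first-order formulae (no temporal operators); $\mathcal S$ (step part) is a finite set of step clauses, each either ground, $l\Rightarrow\bigcirc m$ with $l,m$ propositional literals, or non-ground, $L(x)\Rightarrow\bigcirc M(x)$ with $L(x),M(x)$ unary literals, no two different step clauses having the same left-hand side; $\mathcal E$ (eventuality part) is a finite set of eventuality clauses, each either ground, $\Diamond l$ with $l$ a propositional literal, or non-ground, $\Diamond L(x)$ with $L(x)$ a unary literal. The problem is identified with the formula $\mathcal I\wedge\Box\mathcal U\wedge\Box\forall x\,\mathcal S\wedge\Box\forall x\,\mathcal E$ (finite sets read as conjunctions); satisfiability of the problem means satisfiability of this formula. *)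

theory Defs
  imports "HOL-Library.Countable_Set"
begin

section \<open>First-order temporal formulae\<close>

text \<open>
  There are countably many variables, constants and, for every arity, predicate symbols, all named
  by natural numbers. The predicate symbol of an atom \<open>Pred p ts\<close> is the pair of its name
  \<open>p\<close> and its arity \<open>length ts\<close>, so that \<open>Pred p []\<close> and \<open>Pred p [t]\<close> have different symbols.
\<close>

datatype tm = Var nat | Const nat

datatype fm =
    Top
  | Bot
  | Pred nat "tm list"
  | Neg fm
  | And fm fm
  | Or fm fm
  | Imp fm fm
  | Iff fm fm
  | Forall nat fm
  | Exists nat fm
  | Next fm
  | Sometime fm
  | Always fm
  | Until fm fm
  | WUntil fm fm

instance tm :: countable by countable_datatype
instance fm :: countable by countable_datatype

fun fv_tm :: "tm \<Rightarrow> nat set" where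
  "fv_tm (Var x) = {x}"
| "fv_tm (Const c) = {}"

fun fv :: "fm \<Rightarrow> nat set" where
  "fv Top = {}"
| "fv Bot = {}"
| "fv (Pred p ts) = (\<Union>t\<in>set ts. fv_tm t)"
| "fv (Neg A) = fv A"
| "fv (And A B) = fv A \<union> fv B"
| "fv (Or A B) = fv A \<union> fv B"
| "fv (Imp A B) = fv A \<union> fv B"
| "fv (Iff A B) = fv A \<union> fv B"
| "fv (Forall x A) = fv A - {x}"
| "fv (Exists x A) = fv A - {x}"
| "fv (Next A) = fv A"
| "fv (Sometime A) = fv A"
| "fv (Always A) = fv A"
| "fv (Until A B) = fv A \<union> fv B"
| "fv (WUntil A B) = fv A \<union> fv B"

lemma finite_fv_tm [simp]: "finite (fv_tm t)"
  by (cases t) auto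

lemma finite_fv [simp]: "finite (fv A)"
  by (induction A) auto

fun subfms :: "fm \<Rightarrow> fm set" where
  "subfms Top = {Top}"
| "subfms Bot = {Bot}"
| "subfms (Pred p ts) = {Pred p ts}"
| "subfms (Neg A) = insert (Neg A) (subfms A)"
| "subfms (And A B) = insert (And A B) (subfms A \<union> subfms B)"
| "subfms (Or A B) = insert (Or A B) (subfms A \<union> subfms B)"
| "subfms (Imp A B) = insert (Imp A B) (subfms A \<union> subfms B)"
| "subfms (Iff A B) = insert (Iff A B) (subfms A \<union> subfms B)"
| "subfms (Forall x A) = insert (Forall x A) (subfms A)"
| "subfms (Exists x A) = insert (Exists x A) (subfms A)"
| "subfms (Next A) = insert (Next A) (subfms A)"
| "subfms (Sometime A) = insert (Sometime A) (subfms A)"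
| "subfms (Always A) = insert (Always A) (subfms A)"
| "subfms (Until A B) = insert (Until A B) (subfms A \<union> subfms B)"
| "subfms (WUntil A B) = insert (WUntil A B) (subfms A \<union> subfms B)"

fun temporal_main :: "fm \<Rightarrow> bool" where
  "temporal_main (Next A) = True"
| "temporal_main (Sometime A) = True"
| "temporal_main (Always A) = True"
| "temporal_main (Until A B) = True"
| "temporal_main (WUntil A B) = True"
| "temporal_main _ = False"

definition first_order :: "fm \<Rightarrow> bool" where
  "first_order A \<longleftrightarrow> (\<forall>B\<in>subfms A. \<not> temporal_main B)"

definition monodic :: "fm \<Rightarrow> bool" where
  "monodic A \<longleftrightarrow> (\<forall>B\<in>subfms A. temporal_main B \<longrightarrow> card (fv B) \<le> 1)"

text \<open>
  The size of a formula is its number of symbol occurrences, a quantifier together with the variable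
  it binds counting as two.
\<close>

fun fm_size :: "fm \<Rightarrow> nat" where
  "fm_size Top = 1"
| "fm_size Bot = 1"
| "fm_size (Pred p ts) = 1 + length ts"
| "fm_size (Neg A) = 1 + fm_size A"
| "fm_size (And A B) = 1 + fm_size A + fm_size B"
| "fm_size (Or A B) = 1 + fm_size A + fm_size B"
| "fm_size (Imp A B) = 1 + fm_size A + fm_size B"
| "fm_size (Iff A B) = 1 + fm_size A + fm_size B"
| "fm_size (Forall x A) = 2 + fm_size A"
| "fm_size (Exists x A) = 2 + fm_size A"
| "fm_size (Next A) = 1 + fm_size A"
| "fm_size (Sometime A) = 1 + fm_size A"
| "fm_size (Always A) = 1 + fm_size A"
| "fm_size (Until A B) = 1 + fm_size A + fm_size B"
| "fm_size (WUntil A B) = 1 + fm_size A + fm_size B"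

section \<open>Semantics\<close>

text \<open>
  Constants do not depend on time, so rigidity is built in; \<open>trel M n p ds\<close> says that the predicate
  of name \<open>p\<close> and arity \<open>length ds\<close> holds of \<open>ds\<close> at time \<open>n\<close>.
\<close>

record 'd tstruct =
  tdom :: "'d set"
  tcon :: "nat \<Rightarrow> 'd"
  trel :: "nat \<Rightarrow> nat \<Rightarrow> 'd list \<Rightarrow> bool"

definition tstructure :: "'d tstruct \<Rightarrow> bool" where
  "tstructure M \<longleftrightarrow> tdom M \<noteq> {} \<and> range (tcon M) \<subseteq> tdom M"

definition assignment :: "'d tstruct \<Rightarrow> (nat \<Rightarrow> 'd) \<Rightarrow> bool" where
  "assignment M a \<longleftrightarrow> range a \<subseteq> tdom M"

fun eval_tm :: "'d tstruct \<Rightarrow> (nat \<Rightarrow> 'd) \<Rightarrow> tm \<Rightarrow> 'd" where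
  "eval_tm M a (Var x) = a x"
| "eval_tm M a (Const c) = tcon M c"

fun holds :: "'d tstruct \<Rightarrow> nat \<Rightarrow> (nat \<Rightarrow> 'd) \<Rightarrow> fm \<Rightarrow> bool" where
  "holds M n a Top \<longleftrightarrow> True"
| "holds M n a Bot \<longleftrightarrow> False"
| "holds M n a (Pred p ts) \<longleftrightarrow> trel M n p (map (eval_tm M a) ts)"
| "holds M n a (Neg A) \<longleftrightarrow> \<not> holds M n a A"
| "holds M n a (And A B) \<longleftrightarrow> holds M n a A \<and> holds M n a B"
| "holds M n a (Or A B) \<longleftrightarrow> holds M n a A \<or> holds M n a B"
| "holds M n a (Imp A B) \<longleftrightarrow> (holds M n a A \<longrightarrow> holds M n a B)"
| "holds M n a (Iff A B) \<longleftrightarrow> (holds M n a A \<longleftrightarrow> holds M n a B)"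
| "holds M n a (Forall x A) \<longleftrightarrow> (\<forall>d\<in>tdom M. holds M n (a(x := d)) A)"
| "holds M n a (Exists x A) \<longleftrightarrow> (\<exists>d\<in>tdom M. holds M n (a(x := d)) A)"
| "holds M n a (Next A) \<longleftrightarrow> holds M (Suc n) a A"
| "holds M n a (Sometime A) \<longleftrightarrow> (\<exists>m\<ge>n. holds M m a A)"
| "holds M n a (Always A) \<longleftrightarrow> (\<forall>m\<ge>n. holds M m a A)"
| "holds M n a (Until A B) \<longleftrightarrow>
     (\<exists>m\<ge>n. holds M m a B \<and> (\<forall>i. n \<le> i \<and> i < m \<longrightarrow> holds M i a A))"
| "holds M n a (WUntil A B) \<longleftrightarrow>
     (\<exists>m\<ge>n. holds M m a B \<and> (\<forall>i. n \<le> i \<and> i < m \<longrightarrow> holds M i a A)) \<or>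
     (\<forall>m\<ge>n. holds M m a A)"

text \<open>
  HOL cannot quantify over all types inside a formula, so satisfiability is defined with domains
  that are sets of natural numbers. Nothing is lost: by the Loewenheim-Skolem argument
  below (theorem \<open>satisfiableI\<close>), a formula with a model over a domain of any type whatsoever is
  satisfiable in this sense.
\<close>

definition satisfiable :: "fm \<Rightarrow> bool" where
  "satisfiable A \<longleftrightarrow>
     (\<exists>(M :: nat tstruct) a. tstructure M \<and> assignment M a \<and> holds M 0 a A)"

lemma eval_tm_cong: "(\<And>x. x \<in> fv_tm t \<Longrightarrow> a x = b x) \<Longrightarrow> eval_tm M a t = eval_tm M b t"
  by (cases t) auto

lemma holds_cong: "(\<And>x. x \<in> fv A \<Longrightarrow> a x = b x) \<Longrightarrow> holds M n a A \<longleftrightarrow> holds M n b A"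
proof (induction A arbitrary: n a b)
  case (Pred p ts)
  have "map (eval_tm M a) ts = map (eval_tm M b) ts"
    using Pred by (auto intro!: eval_tm_cong)
  then show ?case by (simp only: holds.simps)
next
  case (Neg A)
  from Neg.IH[of a b] Neg.prems show ?case by simp
next
  case (And A B)
  from And.IH(1)[of a b] And.IH(2)[of a b] And.prems show ?case by simp
next
  case (Or A B)
  from Or.IH(1)[of a b] Or.IH(2)[of a b] Or.prems show ?case by simp
next
  case (Imp A B)
  from Imp.IH(1)[of a b] Imp.IH(2)[of a b] Imp.prems show ?case by simp
next
  case (Iff A B)
  from Iff.IH(1)[of a b] Iff.IH(2)[of a b] Iff.prems show ?case by simp
next
  case (Forall x A)
  have "holds M n (a(x := d)) A \<longleftrightarrow> holds M n (b(x := d)) A" for d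
    using Forall.prems by (intro Forall.IH) auto
  then show ?case by simp
next
  case (Exists x A)
  have "holds M n (a(x := d)) A \<longleftrightarrow> holds M n (b(x := d)) A" for d
    using Exists.prems by (intro Exists.IH) auto
  then show ?case by simp
next
  case (Next A)
  from Next.IH[of a b] Next.prems show ?case by simp
next
  case (Sometime A)
  from Sometime.IH[of a b] Sometime.prems show ?case by simp
next
  case (Always A)
  from Always.IH[of a b] Always.prems show ?case by simp
next
  case (Until A B)
  from Until.IH(1)[of a b] Until.IH(2)[of a b] Until.prems show ?case by simp
next
  case (WUntil A B)
  from WUntil.IH(1)[of a b] WUntil.IH(2)[of a b] WUntil.prems show ?case by simp
qed auto

definition fin_asg :: "'d \<Rightarrow> 'd list \<Rightarrow> nat \<Rightarrow> 'd" where
  "fin_asg d0 l i = (if i < length l then l ! i else d0)"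

definition witness :: "'d tstruct \<Rightarrow> 'd \<Rightarrow> fm \<times> nat \<times> nat \<times> 'd list \<Rightarrow> 'd" where
  "witness M d0 = (\<lambda>(A, n, x, l).
     if \<exists>d\<in>tdom M. holds M n ((fin_asg d0 l)(x := d)) A
     then SOME d. d \<in> tdom M \<and> holds M n ((fin_asg d0 l)(x := d)) A
     else d0)"

primrec hull_stage :: "'d tstruct \<Rightarrow> (nat \<Rightarrow> 'd) \<Rightarrow> nat \<Rightarrow> 'd set" where
  "hull_stage M a0 0 = range a0 \<union> range (tcon M)"
| "hull_stage M a0 (Suc k) = hull_stage M a0 k \<union>
     witness M (a0 0) ` (UNIV \<times> UNIV \<times> UNIV \<times> lists (hull_stage M a0 k))"

definition hull :: "'d tstruct \<Rightarrow> (nat \<Rightarrow> 'd) \<Rightarrow> 'd set" where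
  "hull M a0 = (\<Union>k. hull_stage M a0 k)"

lemma countable_hull: "countable (hull M a0)"
proof -
  have "countable (hull_stage M a0 k)" for k
    by (induction k) (auto intro!: countable_Un countable_image countable_SIGMA countable_lists)
  then show ?thesis
    by (auto simp: hull_def)
qed

lemma witness_in_dom: "d0 \<in> tdom M \<Longrightarrow> witness M d0 q \<in> tdom M"
  unfolding witness_def
  by (cases q) (auto, metis (mono_tags, lifting) someI_ex)

lemma witness_holds:
  assumes "d \<in> tdom M" "holds M n ((fin_asg d0 l)(x := d)) A"
  shows "holds M n ((fin_asg d0 l)(x := witness M d0 (A, n, x, l))) A"
proof -
  let ?P = "\<lambda>d. d \<in> tdom M \<and> holds M n ((fin_asg d0 l)(x := d)) A"
  have "?P (SOME d. ?P d)" using assms by (intro someI[of ?P d]) simp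
  moreover have "witness M d0 (A, n, x, l) = (SOME d. ?P d)"
    using assms by (auto simp: witness_def)
  ultimately show ?thesis by simp
qed

lemma hull_subset:
  assumes "tstructure M" "assignment M a0"
  shows "hull M a0 \<subseteq> tdom M"
proof -
  have "hull_stage M a0 k \<subseteq> tdom M" for k
    using assms by (induction k) (auto simp: tstructure_def assignment_def intro!: witness_in_dom)
  then show ?thesis by (auto simp: hull_def)
qed

lemma witness_in_hull:
  assumes "set l \<subseteq> hull M a0"
  shows "witness M (a0 0) (A, n, x, l) \<in> hull M a0"
proof -
  have mono: "hull_stage M a0 i \<subseteq> hull_stage M a0 j" if "i \<le> j" for i j
    by (rule lift_Suc_mono_le[OF _ that]) auto
  have "\<exists>k. set l \<subseteq> hull_stage M a0 k"
    using assms
  proof (induction l)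
    case (Cons d l)
    then obtain k where "set l \<subseteq> hull_stage M a0 k" by auto
    moreover from Cons.prems obtain k' where "d \<in> hull_stage M a0 k'"
      by (auto simp: hull_def)
    ultimately have "set (d # l) \<subseteq> hull_stage M a0 (max k k')"
      using mono[of k "max k k'"] mono[of k' "max k k'"] by auto
    then show ?case ..
  qed simp
  then obtain k where "l \<in> lists (hull_stage M a0 k)" by auto
  then have "witness M (a0 0) (A, n, x, l) \<in> hull_stage M a0 (Suc k)" by auto
  then show ?thesis unfolding hull_def by blast
qed

lemma hull_witness:
  assumes a: "range a \<subseteq> hull M a0" and d: "d \<in> tdom M" "holds M n (a(x := d)) A"
  shows "\<exists>e\<in>hull M a0. holds M n (a(x := e)) A"
proof -
  obtain N where N: "\<And>i. i \<in> fv A \<Longrightarrow> i < N"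
    using finite_nat_set_iff_bounded[of "fv A"] by auto
  define l where "l = map a [0..<N]"
  have same: "holds M n ((fin_asg (a0 0) l)(x := e)) A \<longleftrightarrow> holds M n (a(x := e)) A" for e
    by (rule holds_cong) (auto simp: fin_asg_def l_def dest: N)
  have "holds M n (a(x := witness M (a0 0) (A, n, x, l))) A"
    using witness_holds[OF d(1), of n "a0 0" l x A] d(2) same by blast
  moreover have "witness M (a0 0) (A, n, x, l) \<in> hull M a0"
    using a by (intro witness_in_hull) (auto simp: l_def)
  ultimately show ?thesis by blast
qed

lemma range_upd: "range a \<subseteq> H \<Longrightarrow> e \<in> H \<Longrightarrow> range (a(x := e)) \<subseteq> H"
  by auto

lemma eval_tm_dom: "eval_tm (M\<lparr>tdom := H\<rparr>) a t = eval_tm M a t"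
  by (cases t) auto

lemma holds_hull:
  assumes "hull M a0 \<subseteq> tdom M" "range a \<subseteq> hull M a0"
  shows "holds (M\<lparr>tdom := hull M a0\<rparr>) n a A \<longleftrightarrow> holds M n a A"
  using assms(2)
proof (induction A arbitrary: n a)
  case (Pred p ts)
  then show ?case by (simp add: eval_tm_dom cong: map_cong)
next
  case (Exists x A)
  have "holds (M\<lparr>tdom := hull M a0\<rparr>) n a (Exists x A) \<longleftrightarrow>
      (\<exists>e\<in>hull M a0. holds M n (a(x := e)) A)"
    using Exists.IH[OF range_upd[OF Exists.prems]] by (simp del: fun_upd_apply)
  also have "\<dots> \<longleftrightarrow> (\<exists>e\<in>tdom M. holds M n (a(x := e)) A)"
    using hull_witness[OF Exists.prems, of _ n x A] assms(1) by blast
  finally show ?case by simp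
next
  case (Forall x A)
  have "holds (M\<lparr>tdom := hull M a0\<rparr>) n a (Forall x A) \<longleftrightarrow>
      (\<forall>e\<in>hull M a0. holds M n (a(x := e)) A)"
    using Forall.IH[OF range_upd[OF Forall.prems]] by (simp del: fun_upd_apply)
  also have "\<dots> \<longleftrightarrow> (\<forall>e\<in>tdom M. holds M n (a(x := e)) A)"
    using hull_witness[OF Forall.prems, of _ n x "Neg A"] assms(1) by auto
  finally show ?case by simp
qed simp_all

definition image_struct :: "('d \<Rightarrow> 'e) \<Rightarrow> 'd tstruct \<Rightarrow> 'e tstruct" where
  "image_struct g M = \<lparr>tdom = g ` tdom M, tcon = g \<circ> tcon M,
     trel = (\<lambda>n p es. trel M n p (map (inv_into (tdom M) g) es))\<rparr>"

lemma holds_image_struct: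
  assumes inj: "inj_on g (tdom M)" and M: "range (tcon M) \<subseteq> tdom M" and a: "range a \<subseteq> tdom M"
  shows "holds (image_struct g M) n (g \<circ> a) A \<longleftrightarrow> holds M n a A"
  using a
proof (induction A arbitrary: n a)
  case (Pred p ts)
  have "inv_into (tdom M) g (eval_tm (image_struct g M) (g \<circ> a) t) = eval_tm M a t" for t
    using Pred M inj by (cases t) (auto simp: image_struct_def intro!: inv_into_f_f)
  then have "map (inv_into (tdom M) g) (map (eval_tm (image_struct g M) (g \<circ> a)) ts) =
      map (eval_tm M a) ts" by simp
  moreover have "trel (image_struct g M) n p es = trel M n p (map (inv_into (tdom M) g) es)"
    for es by (simp add: image_struct_def)
  ultimately show ?case by (simp only: holds.simps)
next
  case (Forall x A)
  have "holds (image_struct g M) n ((g \<circ> a)(x := g d)) A \<longleftrightarrow> holds M n (a(x := d)) A"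
    if "d \<in> tdom M" for d
    using Forall.IH[OF range_upd[OF Forall.prems that]] by (simp only: fun_upd_comp)
  moreover have "tdom (image_struct g M) = g ` tdom M" by (simp add: image_struct_def)
  ultimately show ?case by (simp add: comp_def del: fun_upd_apply)
next
  case (Exists x A)
  have "holds (image_struct g M) n ((g \<circ> a)(x := g d)) A \<longleftrightarrow> holds M n (a(x := d)) A"
    if "d \<in> tdom M" for d
    using Exists.IH[OF range_upd[OF Exists.prems that]] by (simp only: fun_upd_comp)
  moreover have "tdom (image_struct g M) = g ` tdom M" by (simp add: image_struct_def)
  ultimately show ?case by (simp add: comp_def del: fun_upd_apply)
qed simp_all

theorem satisfiableI:
  fixes M :: "'d tstruct"
  assumes M: "tstructure M" and a: "assignment M a" and h: "holds M 0 a A"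
  shows "satisfiable A"
proof -
  define H where "H = M\<lparr>tdom := hull M a\<rparr>"
  define g where "g = to_nat_on (hull M a)"
  have sub: "hull M a \<subseteq> tdom M" by (rule hull_subset[OF M a])
  have "hull_stage M a 0 \<subseteq> hull M a" unfolding hull_def by blast
  then have ra: "range a \<subseteq> tdom H" and rc: "range (tcon H) \<subseteq> tdom H"
    by (auto simp: H_def)
  have "inj_on g (tdom H)"
    by (simp add: g_def H_def inj_on_to_nat_on countable_hull)
  then have "holds (image_struct g H) 0 (g \<circ> a) A \<longleftrightarrow> holds H 0 a A"
    using rc ra by (rule holds_image_struct)
  also have "\<dots> \<longleftrightarrow> holds M 0 a A"
    unfolding H_def using sub ra by (intro holds_hull) (auto simp: H_def)
  finally have "holds (image_struct g H) 0 (g \<circ> a) A" using h by blast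
  moreover have "tstructure (image_struct g H)" "assignment (image_struct g H) (g \<circ> a)"
    using ra rc by (auto simp: tstructure_def assignment_def image_struct_def)
  ultimately show ?thesis unfolding satisfiable_def by blast
qed

section \<open>Divided Separated Normal Form\<close>

datatype lit = PosL nat | NegL nat

fun lit_fm :: "tm list \<Rightarrow> lit \<Rightarrow> fm" where
  "lit_fm ts (PosL p) = Pred p ts"
| "lit_fm ts (NegL p) = Neg (Pred p ts)"

text \<open>
  A literal \<open>l\<close> is read as the propositional literal \<open>lit_fm [] l\<close> in ground clauses and as
  the unary literal \<open>lit_fm [Var 0] l\<close> in non-ground ones; \<open>Var 0\<close> is the common variable
  \<open>x\<close> of all non-ground clauses.
\<close>

datatype step_clause = StepG lit lit | StepN lit lit

datatype ev_clause = EvG lit | EvN lit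

fun step_lhs :: "step_clause \<Rightarrow> fm" where
  "step_lhs (StepG l m) = lit_fm [] l"
| "step_lhs (StepN l m) = lit_fm [Var 0] l"

fun step_rhs :: "step_clause \<Rightarrow> fm" where
  "step_rhs (StepG l m) = lit_fm [] m"
| "step_rhs (StepN l m) = lit_fm [Var 0] m"

definition step_fm :: "step_clause \<Rightarrow> fm" where
  "step_fm s = Imp (step_lhs s) (Next (step_rhs s))"

fun ev_fm :: "ev_clause \<Rightarrow> fm" where
  "ev_fm (EvG l) = Sometime (lit_fm [] l)"
| "ev_fm (EvN l) = Sometime (lit_fm [Var 0] l)"

text \<open>The finite sets of a problem are given by lists of their elements.\<close>

record problem =
  univ_part :: "fm list"
  init_part :: "fm list"
  step_part :: "step_clause list"
  ev_part :: "ev_clause list"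

definition dsnf :: "problem \<Rightarrow> bool" where
  "dsnf P \<longleftrightarrow>
     (\<forall>A\<in>set (univ_part P) \<union> set (init_part P). first_order A \<and> fv A = {}) \<and>
     (\<forall>s\<in>set (step_part P). \<forall>t\<in>set (step_part P). step_lhs s = step_lhs t \<longrightarrow> s = t)"

fun conj_list :: "fm list \<Rightarrow> fm" where
  "conj_list [] = Top"
| "conj_list (A # As) = And A (conj_list As)"

definition problem_fm :: "problem \<Rightarrow> fm" where
  "problem_fm P =
     And (conj_list (init_part P))
      (And (Always (conj_list (univ_part P)))
        (And (Always (Forall 0 (conj_list (map step_fm (step_part P)))))
             (Always (Forall 0 (conj_list (map ev_fm (ev_part P)))))))"

lemma subfms_conj_list:
  "subfms (conj_list As) \<subseteq> (\<Union>A\<in>set As. subfms A) \<union> range conj_list"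
  by (induction As) (auto intro: rangeI[of conj_list "[]", simplified]
      rangeI[of conj_list "_ # _", simplified])

lemma not_temporal_conj_list: "\<not> temporal_main (conj_list As)"
  by (cases As) auto

lemma fv_conj_list: "fv (conj_list As) = (\<Union>A\<in>set As. fv A)"
  by (induction As) auto

lemma subfms_lit_fm: "B \<in> subfms (lit_fm ts l) \<Longrightarrow> \<not> temporal_main B"
  by (cases l) auto

lemma fv_lit_fm: "fv (lit_fm ts l) = (\<Union>t\<in>set ts. fv_tm t)"
  by (cases l) auto

lemma monodic_problem_fm:
  assumes "dsnf P"
  shows "monodic (problem_fm P)"
proof -
  have conj: "monodic (conj_list As)" if "\<And>A. A \<in> set As \<Longrightarrow> monodic A" for As
    using that subfms_conj_list[of As] not_temporal_conj_list
    by (fastforce simp: monodic_def)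
  have fo: "monodic A" if "A \<in> set (univ_part P) \<union> set (init_part P)" for A
    using assms that by (auto simp: dsnf_def first_order_def monodic_def)
  have lits: "monodic (lit_fm ts l)" for ts l
    using subfms_lit_fm by (auto simp: monodic_def)
  have step: "monodic (step_fm s)" for s
    using lits by (cases s) (auto simp: monodic_def step_fm_def fv_lit_fm)
  have ev: "monodic (ev_fm e)" for e
    using lits by (cases e) (auto simp: monodic_def fv_lit_fm)
  have fv: "fv (step_fm s) \<subseteq> {0}" "fv (ev_fm e) \<subseteq> {0}" for s e
    by (cases s, auto simp: step_fm_def fv_lit_fm) (cases e, auto simp: fv_lit_fm)
  have "fv (Always (Forall 0 (conj_list (map step_fm (step_part P))))) = {}"
      "fv (Always (Forall 0 (conj_list (map ev_fm (ev_part P))))) = {}"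
    using fv by (auto simp: fv_conj_list)
  moreover have "fv (Always (conj_list (univ_part P))) = {}"
    using assms by (auto simp: dsnf_def fv_conj_list)
  moreover have "monodic (conj_list (init_part P))" "monodic (conj_list (univ_part P))"
      "monodic (conj_list (map step_fm (step_part P)))"
      "monodic (conj_list (map ev_fm (ev_part P)))"
    using fo step ev by (auto intro!: conj)
  ultimately show ?thesis
    by (auto simp: problem_fm_def monodic_def simp del: fv.simps)
qed

section \<open>Effectiveness\<close>

text \<open>
  The model of computation is a minimal first-order Lisp. Data are binary trees. A program is a
  finite list of function bodies, which may call each other recursively; the \<open>i\<close>-th function is
  called with \<open>CallE i\<close>. Evaluation is call by value, a divergent computation having no value.
\<close>

datatype bt = Lf | Br bt bt

datatype expr =
    ArgE nat
  | LfE
  | BrE expr expr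
  | HeadE expr
  | TailE expr
  | IfE expr expr expr
  | CallE nat "expr list"

inductive evaluates :: "expr list \<Rightarrow> bt list \<Rightarrow> expr \<Rightarrow> bt \<Rightarrow> bool"
  for prog :: "expr list" where
  ArgE: "i < length args \<Longrightarrow> evaluates prog args (ArgE i) (args ! i)"
| LfE: "evaluates prog args LfE Lf"
| BrE: "evaluates prog args e1 v1 \<Longrightarrow> evaluates prog args e2 v2 \<Longrightarrow>
    evaluates prog args (BrE e1 e2) (Br v1 v2)"
| HeadE: "evaluates prog args e (Br v1 v2) \<Longrightarrow> evaluates prog args (HeadE e) v1"
| TailE: "evaluates prog args e (Br v1 v2) \<Longrightarrow> evaluates prog args (TailE e) v2"
| IfBr: "evaluates prog args e (Br v1 v2) \<Longrightarrow> evaluates prog args e1 v \<Longrightarrow>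
    evaluates prog args (IfE e e1 e2) v"
| IfLf: "evaluates prog args e Lf \<Longrightarrow> evaluates prog args e2 v \<Longrightarrow>
    evaluates prog args (IfE e e1 e2) v"
| CallE: "list_all2 (evaluates prog args) es vs \<Longrightarrow> i < length prog \<Longrightarrow>
    evaluates prog vs (prog ! i) v \<Longrightarrow> evaluates prog args (CallE i es) v"

lemma evaluates_deterministic:
  "evaluates prog args e v \<Longrightarrow> evaluates prog args e w \<Longrightarrow> v = w"
proof (induction arbitrary: w rule: evaluates.induct)
  case (CallE args es vs i v)
  from CallE.prems obtain vs' where vs': "list_all2 (evaluates prog args) es vs'"
      "evaluates prog vs' (prog ! i) w"
    by (cases rule: evaluates.cases) auto
  have "vs = vs'"
  proof (rule nth_equalityI)
    show "length vs = length vs'"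
      using CallE.IH(1) vs'(1) by (auto dest!: list_all2_lengthD)
    show "vs ! j = vs' ! j" if "j < length vs" for j
      using CallE.IH(1) vs'(1) that by (auto simp: list_all2_conv_all_nth)
  qed
  then show ?case using CallE.IH(2) vs'(2) by blast
next
  case (ArgE i args)
  from ArgE.prems ArgE.hyps show ?case by (cases rule: evaluates.cases) auto
next
  case (LfE args)
  then show ?case by (cases rule: evaluates.cases) auto
next
  case (BrE args e1 v1 e2 v2)
  from BrE.prems BrE.IH show ?case by (cases rule: evaluates.cases) auto
next
  case (HeadE args e v1 v2)
  from HeadE.prems HeadE.IH show ?case by (cases rule: evaluates.cases) auto
next
  case (TailE args e v1 v2)
  from TailE.prems TailE.IH show ?case by (cases rule: evaluates.cases) auto
next
  case (IfBr args e v1 v2 e1 v e2)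
  from IfBr.prems IfBr.IH show ?case by (cases rule: evaluates.cases) auto
next
  case (IfLf args e e2 v e1)
  from IfLf.prems IfLf.IH show ?case by (cases rule: evaluates.cases) auto
qed

definition effective_on ::
  "'a set \<Rightarrow> ('a \<Rightarrow> bt) \<Rightarrow> ('b \<Rightarrow> bt) \<Rightarrow> ('a \<Rightarrow> 'b) \<Rightarrow> bool" where
  "effective_on X code_in code_out f \<longleftrightarrow>
     (\<exists>prog. \<forall>x\<in>X. evaluates prog [code_in x] (CallE 0 [ArgE 0]) (code_out (f x)))"

text \<open>
  Codes: a natural number is a list of leaves, and a constructor term is the list of the number of
  the constructor followed by the codes of the arguments.
\<close>

fun list_code :: "bt list \<Rightarrow> bt" where
  "list_code [] = Lf"
| "list_code (v # vs) = Br v (list_code vs)"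

definition nat_code :: "nat \<Rightarrow> bt" where
  "nat_code n = list_code (replicate n Lf)"

definition node :: "nat \<Rightarrow> bt list \<Rightarrow> bt" where
  "node k vs = Br (nat_code k) (list_code vs)"

fun tm_code :: "tm \<Rightarrow> bt" where
  "tm_code (Var x) = node 0 [nat_code x]"
| "tm_code (Const c) = node 1 [nat_code c]"

fun fm_code :: "fm \<Rightarrow> bt" where
  "fm_code Top = node 0 []"
| "fm_code Bot = node 1 []"
| "fm_code (Pred p ts) = node 2 [nat_code p, list_code (map tm_code ts)]"
| "fm_code (Neg A) = node 3 [fm_code A]"
| "fm_code (And A B) = node 4 [fm_code A, fm_code B]"
| "fm_code (Or A B) = node 5 [fm_code A, fm_code B]"
| "fm_code (Imp A B) = node 6 [fm_code A, fm_code B]"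
| "fm_code (Iff A B) = node 7 [fm_code A, fm_code B]"
| "fm_code (Forall x A) = node 8 [nat_code x, fm_code A]"
| "fm_code (Exists x A) = node 9 [nat_code x, fm_code A]"
| "fm_code (Next A) = node 10 [fm_code A]"
| "fm_code (Sometime A) = node 11 [fm_code A]"
| "fm_code (Always A) = node 12 [fm_code A]"
| "fm_code (Until A B) = node 13 [fm_code A, fm_code B]"
| "fm_code (WUntil A B) = node 14 [fm_code A, fm_code B]"

fun lit_code :: "lit \<Rightarrow> bt" where
  "lit_code (PosL p) = node 0 [nat_code p]"
| "lit_code (NegL p) = node 1 [nat_code p]"

fun step_code :: "step_clause \<Rightarrow> bt" where
  "step_code (StepG l m) = node 0 [lit_code l, lit_code m]"
| "step_code (StepN l m) = node 1 [lit_code l, lit_code m]"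

fun ev_code :: "ev_clause \<Rightarrow> bt" where
  "ev_code (EvG l) = node 0 [lit_code l]"
| "ev_code (EvN l) = node 1 [lit_code l]"

definition problem_code :: "problem \<Rightarrow> bt" where
  "problem_code P = list_code
     [list_code (map fm_code (univ_part P)), list_code (map fm_code (init_part P)),
      list_code (map step_code (step_part P)), list_code (map ev_code (ev_part P))]"

lemma list_code_inject [simp]: "list_code vs = list_code ws \<longleftrightarrow> vs = ws"
proof (induction vs arbitrary: ws)
  case Nil
  show ?case by (cases ws) auto
next
  case (Cons v vs)
  then show ?case by (cases ws) auto
qed

lemma nat_code_inject [simp]: "nat_code m = nat_code n \<longleftrightarrow> m = n"
  by (auto simp: nat_code_def dest: arg_cong[of _ _ length])

lemma node_inject [simp]: "node k vs = node m ws \<longleftrightarrow> k = m \<and> vs = ws"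
  by (simp add: node_def)

lemma inj_tm_code: "inj tm_code"
proof
  fix s t assume "tm_code s = tm_code t"
  then show "s = t" by (cases s; cases t) auto
qed

lemma fm_code_inject: "fm_code A = fm_code B \<Longrightarrow> A = B"
proof (induction A arbitrary: B)
  case (Pred p ts)
  then show ?case by (cases B) (auto simp: inj_map_eq_map[OF inj_tm_code])
next
  case Top
  then show ?case by (cases B) auto
next
  case Bot
  then show ?case by (cases B) auto
next
  case (Neg A)
  from Neg.prems Neg.IH show ?case by (cases B) auto
next
  case (And A1 A2)
  from And.prems And.IH show ?case by (cases B) auto
next
  case (Or A1 A2)
  from Or.prems Or.IH show ?case by (cases B) auto
next
  case (Imp A1 A2)
  from Imp.prems Imp.IH show ?case by (cases B) auto
next
  case (Iff A1 A2)
  from Iff.prems Iff.IH show ?case by (cases B) auto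
next
  case (Forall x A)
  from Forall.prems Forall.IH show ?case by (cases B) auto
next
  case (Exists x A)
  from Exists.prems Exists.IH show ?case by (cases B) auto
next
  case (Next A)
  from Next.prems Next.IH show ?case by (cases B) auto
next
  case (Sometime A)
  from Sometime.prems Sometime.IH show ?case by (cases B) auto
next
  case (Always A)
  from Always.prems Always.IH show ?case by (cases B) auto
next
  case (Until A1 A2)
  from Until.prems Until.IH show ?case by (cases B) auto
next
  case (WUntil A1 A2)
  from WUntil.prems WUntil.IH show ?case by (cases B) auto
qed

lemma inj_fm_code: "inj fm_code"
  by (rule injI) (rule fm_code_inject)

lemma inj_lit_code: "inj lit_code"
proof
  fix l m assume "lit_code l = lit_code m"
  then show "l = m" by (cases l; cases m) auto
qed

lemma inj_step_code: "inj step_code"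
proof
  fix s t assume "step_code s = step_code t"
  then show "s = t" by (cases s; cases t) (auto dest: injD[OF inj_lit_code])
qed

lemma inj_ev_code: "inj ev_code"
proof
  fix s t assume "ev_code s = ev_code t"
  then show "s = t" by (cases s; cases t) (auto dest: injD[OF inj_lit_code])
qed

lemma inj_problem_code: "inj problem_code"
proof
  fix P Q :: problem assume "problem_code P = problem_code Q"
  then show "P = Q"
    by (auto simp: problem_code_def inj_map_eq_map inj_fm_code inj_step_code inj_ev_code
        intro!: problem.equality)
qed

end

theory Submission
  imports Defs
begin

text \<open>
  Every temporal subformula is named by a unary predicate and replaced by an atom of it; monodicity
  is what makes arity one suffice. The next-time operator between named formulae is expressed by two
  step clauses. Until and weak until satisfy the fixpoint equation \<open>P \<leftrightarrow> B \<or> (A \<and> \<circle>P)\<close>, which is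
  first-order once \<open>\<circle>P\<close> is named, and an unconditional eventuality singles out the intended
  solution. Each definition mentions its subformulae once, whence linear size.
\<close>

section \<open>The translation\<close>

text \<open>Names belong to occurrences: the index \<open>j\<close> counts temporal subformulae in
  preorder, so equal subformulae get separate names and neither an equality test on formulae nor a
  search for fresh symbols is needed. All definitions are equivalences, so replacement is sound
  under any polarity and no negation normal form is required. An eventuality of the normal form
  cannot be conditional on P. The formula P -> B avoids the condition: in the intended model of
  until it holds now if P fails now, and otherwise at the time that fulfils P. Conversely, its
  recurrence forbids postponing B forever through A and next P. A step clause is only an implication
  between literals; the clauses for both polarities together give the equivalence of role 1 with the
  next value of role 0. Closed temporal subformulae are also named by unary predicates, applied to
  \<open>Const 0\<close>, so one scheme covers both cases and no ground clause arises. The initial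
  part must be closed although the given formula may have free variables, hence the existential
  closure. Size stays linear because a predicate symbol counts as one whatever its index.\<close>

fun tm_vars :: "tm list \<Rightarrow> nat list" where
  "tm_vars [] = []"
| "tm_vars (Var x # ts) = x # tm_vars ts"
| "tm_vars (Const c # ts) = tm_vars ts"

text \<open>A list, because the program has to compute it. Duplicates are harmless: it serves to
  pick an anchor and to form an existential closure.\<close>

fun fvs :: "fm \<Rightarrow> nat list" where
  "fvs Top = []"
| "fvs Bot = []"
| "fvs (Pred p ts) = tm_vars ts"
| "fvs (Neg A) = fvs A"
| "fvs (And A B) = fvs A @ fvs B"
| "fvs (Or A B) = fvs A @ fvs B"
| "fvs (Imp A B) = fvs A @ fvs B"
| "fvs (Iff A B) = fvs A @ fvs B"
| "fvs (Forall x A) = removeAll x (fvs A)"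
| "fvs (Exists x A) = removeAll x (fvs A)"
| "fvs (Next A) = fvs A"
| "fvs (Sometime A) = fvs A"
| "fvs (Always A) = fvs A"
| "fvs (Until A B) = fvs A @ fvs B"
| "fvs (WUntil A B) = fvs A @ fvs B"

definition anchor_var :: "fm \<Rightarrow> nat" where
  "anchor_var A = (case fvs A of [] \<Rightarrow> 0 | x # xs \<Rightarrow> x)"

text \<open>For a closed formula a constant is taken, so that the atom replacing it has no new free
  variable.\<close>

definition anchor_tm :: "fm \<Rightarrow> tm" where
  "anchor_tm A = (case fvs A of [] \<Rightarrow> Const 0 | x # xs \<Rightarrow> Var x)"

fun temporals :: "fm \<Rightarrow> fm list" where
  "temporals Top = []"
| "temporals Bot = []"
| "temporals (Pred p ts) = []"
| "temporals (Neg A) = temporals A"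
| "temporals (And A B) = temporals A @ temporals B"
| "temporals (Or A B) = temporals A @ temporals B"
| "temporals (Imp A B) = temporals A @ temporals B"
| "temporals (Iff A B) = temporals A @ temporals B"
| "temporals (Forall x A) = temporals A"
| "temporals (Exists x A) = temporals A"
| "temporals (Next A) = Next A # temporals A"
| "temporals (Sometime A) = Sometime A # temporals A"
| "temporals (Always A) = Always A # temporals A"
| "temporals (Until A B) = Until A B # temporals A @ temporals B"
| "temporals (WUntil A B) = WUntil A B # temporals A @ temporals B"

abbreviation ntemp :: "fm \<Rightarrow> nat" where
  "ntemp A \<equiv> length (temporals A)"

text \<open>
  The \<open>j\<close>-th temporal subformula \<open>\<psi>\<close> in preorder owns four unary predicates \<open>aux r j\<close>.
  Role 1 is the next-time value of role 0. Role 0 is \<open>\<psi>\<close> itself, except that for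
  \<open>\<psi> = Next A\<close> it is \<open>A\<close> and role 1 is \<open>\<psi>\<close>. Role 2 is the eventuality of \<open>\<psi>\<close>; role 3
  names the argument of \<open>\<psi>\<close> that is needed twice. Atoms of the given formula are padded to arity
  at least two, so no name can clash with these.
\<close>

definition aux :: "nat \<Rightarrow> nat \<Rightarrow> tm \<Rightarrow> fm" where
  "aux r j t = Pred (4 * j + r) [t]"

fun flat :: "fm \<Rightarrow> nat \<Rightarrow> fm" where
  "flat Top j = Top"
| "flat Bot j = Bot"
| "flat (Pred p ts) j = Pred p (Const 0 # Const 0 # ts)"
| "flat (Neg A) j = Neg (flat A j)"
| "flat (And A B) j = And (flat A j) (flat B (ntemp A + j))"
| "flat (Or A B) j = Or (flat A j) (flat B (ntemp A + j))"
| "flat (Imp A B) j = Imp (flat A j) (flat B (ntemp A + j))"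
| "flat (Iff A B) j = Iff (flat A j) (flat B (ntemp A + j))"
| "flat (Forall x A) j = Forall x (flat A j)"
| "flat (Exists x A) j = Exists x (flat A j)"
| "flat (Next A) j = aux 1 j (anchor_tm (Next A))"
| "flat (Sometime A) j = aux 0 j (anchor_tm (Sometime A))"
| "flat (Always A) j = aux 0 j (anchor_tm (Always A))"
| "flat (Until A B) j = aux 0 j (anchor_tm (Until A B))"
| "flat (WUntil A B) j = aux 0 j (anchor_tm (WUntil A B))"

text \<open>
  Until is the least and weak until the greatest solution of \<open>P \<leftrightarrow> B \<or> (A \<and> \<circle>P)\<close>. A solution is
  the least one if \<open>P \<rightarrow> B\<close> recurs forever, and the greatest one if \<open>A \<rightarrow> P\<close> does.
\<close>

definition next_def :: "nat \<Rightarrow> nat \<Rightarrow> fm \<Rightarrow> fm" where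
  "next_def y j A = Forall y (Iff (aux 0 j (Var y)) A)"

definition until_def :: "nat \<Rightarrow> nat \<Rightarrow> fm \<Rightarrow> fm \<Rightarrow> fm" where
  "until_def y j A B = Forall y
     (And (Iff (aux 3 j (Var y)) B)
       (And (Iff (aux 0 j (Var y)) (Or (aux 3 j (Var y)) (And A (aux 1 j (Var y)))))
            (Iff (aux 2 j (Var y)) (Imp (aux 0 j (Var y)) (aux 3 j (Var y))))))"

definition wuntil_def :: "nat \<Rightarrow> nat \<Rightarrow> fm \<Rightarrow> fm \<Rightarrow> fm" where
  "wuntil_def y j A B = Forall y
     (And (Iff (aux 3 j (Var y)) A)
       (And (Iff (aux 0 j (Var y)) (Or B (And (aux 3 j (Var y)) (aux 1 j (Var y)))))
            (Iff (aux 2 j (Var y)) (Imp (aux 3 j (Var y)) (aux 0 j (Var y))))))"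

fun defs :: "fm \<Rightarrow> nat \<Rightarrow> fm list" where
  "defs Top j = []"
| "defs Bot j = []"
| "defs (Pred p ts) j = []"
| "defs (Neg A) j = defs A j"
| "defs (And A B) j = defs A j @ defs B (ntemp A + j)"
| "defs (Or A B) j = defs A j @ defs B (ntemp A + j)"
| "defs (Imp A B) j = defs A j @ defs B (ntemp A + j)"
| "defs (Iff A B) j = defs A j @ defs B (ntemp A + j)"
| "defs (Forall x A) j = defs A j"
| "defs (Exists x A) j = defs A j"
| "defs (Next A) j =
     next_def (anchor_var (Next A)) j (flat A (Suc j)) # defs A (Suc j)"
| "defs (Sometime A) j =
     until_def (anchor_var (Sometime A)) j Top (flat A (Suc j)) # defs A (Suc j)"
| "defs (Always A) j =
     wuntil_def (anchor_var (Always A)) j (flat A (Suc j)) Bot # defs A (Suc j)"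
| "defs (Until A B) j =
     until_def (anchor_var (Until A B)) j (flat A (Suc j)) (flat B (ntemp A + Suc j)) #
     defs A (Suc j) @ defs B (ntemp A + Suc j)"
| "defs (WUntil A B) j =
     wuntil_def (anchor_var (WUntil A B)) j (flat A (Suc j)) (flat B (ntemp A + Suc j)) #
     defs A (Suc j) @ defs B (ntemp A + Suc j)"

primrec steps :: "nat \<Rightarrow> step_clause list" where
  "steps 0 = []"
| "steps (Suc j) =
     StepN (PosL (4 * j + 1)) (PosL (4 * j)) # StepN (NegL (4 * j + 1)) (NegL (4 * j)) # steps j"

text \<open>Every index gets an eventuality, also that of a next-time formula, so that the clauses
  depend on the number of indices alone.\<close>

primrec evs :: "nat \<Rightarrow> ev_clause list" where
  "evs 0 = []"
| "evs (Suc j) = EvN (PosL (4 * j + 2)) # evs j"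

definition to_dsnf :: "fm \<Rightarrow> problem" where
  "to_dsnf A = \<lparr>univ_part = defs A 0, init_part = [foldr Exists (fvs A) (flat A 0)],
     step_part = steps (ntemp A), ev_part = evs (ntemp A)\<rparr>"

lemma set_tm_vars: "set (tm_vars ts) = (\<Union>t\<in>set ts. fv_tm t)"
  by (induction ts rule: tm_vars.induct) auto

lemma set_fvs: "set (fvs A) = fv A"
  by (induction A) (auto simp: set_tm_vars)

section \<open>Normal form and size\<close>

lemma fv_anchor_tm: "fv_tm (anchor_tm A) \<subseteq> fv A"
  unfolding anchor_tm_def set_fvs[symmetric] by (cases "fvs A") simp_all

lemma fv_anchor_var:
  assumes "card (fv A) \<le> 1"
  shows "fv A \<subseteq> {anchor_var A}"
proof (cases "fvs A")
  case Nil
  then show ?thesis by (simp flip: set_fvs)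
next
  case (Cons x xs)
  then have "anchor_var A = x" "x \<in> fv A" by (simp_all add: anchor_var_def flip: set_fvs)
  moreover have "\<forall>u\<in>fv A. \<forall>v\<in>fv A. u = v"
    using assms by (simp add: card_le_Suc0_iff_eq)
  ultimately show ?thesis by blast
qed

lemma fv_flat_subset: "x \<in> fv (flat A j) \<Longrightarrow> x \<in> fv A"
proof (induction A arbitrary: j)
  case (Next A)
  then show ?case using fv_anchor_tm[of "Next A"] by (auto simp: aux_def simp del: fv.simps(11))
next
  case (Sometime A)
  then show ?case using fv_anchor_tm[of "Sometime A"] by (auto simp: aux_def simp del: fv.simps(12))
next
  case (Always A)
  then show ?case using fv_anchor_tm[of "Always A"] by (auto simp: aux_def simp del: fv.simps(13))
next
  case (Until A B)
  then show ?case using fv_anchor_tm[of "Until A B"] by (auto simp: aux_def simp del: fv.simps(14))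
next
  case (WUntil A B)
  then show ?case using fv_anchor_tm[of "WUntil A B"] by (auto simp: aux_def simp del: fv.simps(15))
qed auto

lemma fv_flat: "fv (flat A j) \<subseteq> fv A"
  using fv_flat_subset by blast

lemma monodic_simps [simp]:
  "monodic (Neg A) \<longleftrightarrow> monodic A"
  "monodic (And A B) \<longleftrightarrow> monodic A \<and> monodic B"
  "monodic (Or A B) \<longleftrightarrow> monodic A \<and> monodic B"
  "monodic (Imp A B) \<longleftrightarrow> monodic A \<and> monodic B"
  "monodic (Iff A B) \<longleftrightarrow> monodic A \<and> monodic B"
  "monodic (Forall x A) \<longleftrightarrow> monodic A"
  "monodic (Exists x A) \<longleftrightarrow> monodic A"
  "monodic (Next A) \<longleftrightarrow> card (fv (Next A)) \<le> 1 \<and> monodic A"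
  "monodic (Sometime A) \<longleftrightarrow> card (fv (Sometime A)) \<le> 1 \<and> monodic A"
  "monodic (Always A) \<longleftrightarrow> card (fv (Always A)) \<le> 1 \<and> monodic A"
  "monodic (Until A B) \<longleftrightarrow> card (fv (Until A B)) \<le> 1 \<and> monodic A \<and> monodic B"
  "monodic (WUntil A B) \<longleftrightarrow> card (fv (WUntil A B)) \<le> 1 \<and> monodic A \<and> monodic B"
  by (auto simp: monodic_def)

lemma fv_defining_formulae:
  "fv (next_def y j A) = fv A - {y}"
  "fv (until_def y j A B) = fv A \<union> fv B - {y}"
  "fv (wuntil_def y j A B) = fv A \<union> fv B - {y}"
  by (auto simp: next_def_def until_def_def wuntil_def_def aux_def)

lemma fv_defs: "monodic A \<Longrightarrow> U \<in> set (defs A j) \<Longrightarrow> fv U = {}"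
proof (induction A arbitrary: j)
  case (Next A)
  then have "fv (flat A (Suc j)) \<subseteq> {anchor_var (Next A)}"
    using fv_anchor_var[of "Next A"] fv_flat[of A "Suc j"] by simp
  with Next show ?case by (auto simp: fv_defining_formulae)
next
  case (Sometime A)
  then have "fv (flat A (Suc j)) \<subseteq> {anchor_var (Sometime A)}"
    using fv_anchor_var[of "Sometime A"] fv_flat[of A "Suc j"] by simp
  with Sometime show ?case by (auto simp: fv_defining_formulae)
next
  case (Always A)
  then have "fv (flat A (Suc j)) \<subseteq> {anchor_var (Always A)}"
    using fv_anchor_var[of "Always A"] fv_flat[of A "Suc j"] by simp
  with Always show ?case by (auto simp: fv_defining_formulae)
next
  case (Until A B)
  then have "fv (flat A (Suc j)) \<union> fv (flat B (ntemp A + Suc j)) \<subseteq> {anchor_var (Until A B)}"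
    using fv_anchor_var[of "Until A B"] fv_flat[of A "Suc j"] fv_flat[of B "ntemp A + Suc j"]
    by simp blast
  with Until show ?case by (auto simp: fv_defining_formulae)
next
  case (WUntil A B)
  then have "fv (flat A (Suc j)) \<union> fv (flat B (ntemp A + Suc j)) \<subseteq> {anchor_var (WUntil A B)}"
    using fv_anchor_var[of "WUntil A B"] fv_flat[of A "Suc j"] fv_flat[of B "ntemp A + Suc j"]
    by simp blast
  with WUntil show ?case by (auto simp: fv_defining_formulae)
qed auto

lemma first_order_simps [simp]:
  "first_order Top" "first_order Bot" "first_order (Pred p ts)"
  "first_order (Neg A) \<longleftrightarrow> first_order A"
  "first_order (And A B) \<longleftrightarrow> first_order A \<and> first_order B"
  "first_order (Or A B) \<longleftrightarrow> first_order A \<and> first_order B"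
  "first_order (Imp A B) \<longleftrightarrow> first_order A \<and> first_order B"
  "first_order (Iff A B) \<longleftrightarrow> first_order A \<and> first_order B"
  "first_order (Forall x A) \<longleftrightarrow> first_order A"
  "first_order (Exists x A) \<longleftrightarrow> first_order A"
  by (auto simp: first_order_def)

lemma first_order_flat: "first_order (flat A j)"
  by (induction A arbitrary: j) (auto simp: aux_def)

lemma first_order_defs: "U \<in> set (defs A j) \<Longrightarrow> first_order U"
  by (induction A arbitrary: j)
    (auto simp: next_def_def until_def_def wuntil_def_def aux_def first_order_flat)

lemma fv_foldr_Exists: "fv (foldr Exists xs A) = fv A - set xs"
  by (induction xs) auto

lemma first_order_foldr_Exists: "first_order (foldr Exists xs A) \<longleftrightarrow> first_order A"
  by (induction xs) auto

lemma set_steps: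
  "set (steps n) = (\<Union>j<n. {StepN (PosL (4 * j + 1)) (PosL (4 * j)),
                             StepN (NegL (4 * j + 1)) (NegL (4 * j))})"
  by (induction n) (auto simp: lessThan_Suc)

text \<open>The left-hand sides are the two literals over the predicate \<open>4 * j + 1\<close>, so
  each determines its index and polarity and hence its clause. Monodicity is what closes the
  definitions: one quantifier binds everything.\<close>

lemma dsnf_to_dsnf:
  assumes "monodic A"
  shows "dsnf (to_dsnf A)"
proof -
  have "fv (foldr Exists (fvs A) (flat A 0)) = {}"
    using fv_flat[of A 0] by (auto simp: fv_foldr_Exists set_fvs)
  then show ?thesis
    using fv_defs[OF assms] first_order_defs
    by (auto simp: dsnf_def to_dsnf_def first_order_foldr_Exists first_order_flat set_steps)
qed

lemma fm_size_conj_list: "fm_size (conj_list As) = 1 + (\<Sum>A\<leftarrow>As. 1 + fm_size A)"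
  by (induction As) auto

lemma fm_size_pos: "1 \<le> fm_size A"
  by (cases A) auto

lemma fm_size_defining_formulae:
  "fm_size (aux r j t) = 2"
  "fm_size (next_def y j A) = 5 + fm_size A"
  "fm_size (until_def y j A B) = 24 + fm_size A + fm_size B"
  "fm_size (wuntil_def y j A B) = 24 + fm_size A + fm_size B"
  by (simp_all add: aux_def next_def_def until_def_def wuntil_def_def)

text \<open>\<open>flat\<close> and \<open>defs\<close> are bounded jointly, because the translated
  argument of a temporal operator moves from the former into the latter, where it occurs once. The
  dearest operators are sometime and always, adding 28: 24 for the definition, 1 for the constant
  argument, 1 for its conjunction sign, 2 for the atom.\<close>

lemma fm_size_flat_defs:
  "fm_size (flat A j) + (\<Sum>U\<leftarrow>defs A j. 1 + fm_size U) \<le> 32 * fm_size A"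
proof (induction A arbitrary: j)
  case (And A B)
  from And.IH(1)[of j] And.IH(2)[of "ntemp A + j"] show ?case by simp
next
  case (Or A B)
  from Or.IH(1)[of j] Or.IH(2)[of "ntemp A + j"] show ?case by simp
next
  case (Imp A B)
  from Imp.IH(1)[of j] Imp.IH(2)[of "ntemp A + j"] show ?case by simp
next
  case (Iff A B)
  from Iff.IH(1)[of j] Iff.IH(2)[of "ntemp A + j"] show ?case by simp
next
  case (Neg A)
  from Neg.IH[of j] show ?case by simp
next
  case (Forall x A)
  from Forall.IH[of j] show ?case by simp
next
  case (Exists x A)
  from Exists.IH[of j] show ?case by simp
next
  case (Next A)
  from Next.IH[of "Suc j"] show ?case by (simp add: fm_size_defining_formulae)
next
  case (Sometime A)
  from Sometime.IH[of "Suc j"] show ?case by (simp add: fm_size_defining_formulae)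
next
  case (Always A)
  from Always.IH[of "Suc j"] show ?case by (simp add: fm_size_defining_formulae)
next
  case (Until A B)
  from Until.IH(1)[of "Suc j"] Until.IH(2)[of "ntemp A + Suc j"]
  show ?case by (simp add: fm_size_defining_formulae)
next
  case (WUntil A B)
  from WUntil.IH(1)[of "Suc j"] WUntil.IH(2)[of "ntemp A + Suc j"]
  show ?case by (simp add: fm_size_defining_formulae)
qed simp_all

lemma length_tm_vars: "length (tm_vars ts) \<le> length ts"
  by (induction ts rule: tm_vars.induct) auto

lemma length_fvs: "length (fvs A) \<le> fm_size A"
proof (induction A)
  case (Pred p ts)
  then show ?case using length_tm_vars[of ts] by simp
next
  case (Forall x A)
  then show ?case using length_removeAll_less_eq[of x "fvs A"]
    by (simp del: length_removeAll_less_eq)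
next
  case (Exists x A)
  then show ?case using length_removeAll_less_eq[of x "fvs A"]
    by (simp del: length_removeAll_less_eq)
qed auto

lemma ntemp_le: "ntemp A \<le> fm_size A"
  by (induction A) auto

lemma fm_size_foldr_Exists: "fm_size (foldr Exists xs A) = 2 * length xs + fm_size A"
  by (induction xs) auto

lemma sum_steps: "(\<Sum>s\<leftarrow>steps n. Suc (fm_size (step_fm s))) = 16 * n"
  by (induction n) (auto simp: step_fm_def)

lemma sum_evs: "(\<Sum>e\<leftarrow>evs n. Suc (fm_size (ev_fm e))) = 4 * n"
  by (induction n) auto

text \<open>The frame costs 15, the closure at most 2 per symbol, the clauses 20 per index,
  \<open>flat\<close> and \<open>defs\<close> 32 per symbol: a factor 69 in all, rounded up.\<close>

lemma fm_size_to_dsnf: "fm_size (problem_fm (to_dsnf A)) \<le> 100 * fm_size A"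
  using fm_size_flat_defs[of A 0] length_fvs[of A] ntemp_le[of A] fm_size_pos[of A]
  by (simp add: problem_fm_def to_dsnf_def fm_size_conj_list fm_size_foldr_Exists o_def
      sum_steps sum_evs)

section \<open>Models of a formula and of its normal form\<close>

text \<open>If P holds at n, the fixpoint equation carries it forward until B occurs, at the latest
  at the time m where P implies B. This is induction from m backwards, as is the converse from the
  time of B.\<close>

lemma least_solution:
  assumes "\<And>n. P n \<longleftrightarrow> B n \<or> A n \<and> P (Suc n)" and "\<And>n. \<exists>m\<ge>n. P m \<longrightarrow> B m"
  shows "P n \<longleftrightarrow> (\<exists>m\<ge>n. B m \<and> (\<forall>i. n \<le> i \<and> i < m \<longrightarrow> A i))"
proof
  assume "P n"
  obtain m where "m \<ge> n" "P m \<longrightarrow> B m" using assms(2) by blast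
  from this \<open>P n\<close> show "\<exists>m\<ge>n. B m \<and> (\<forall>i. n \<le> i \<and> i < m \<longrightarrow> A i)"
  proof (induction n rule: inc_induct)
    case (step n)
    show ?case
    proof (cases "B n")
      case False
      then have "A n" "P (Suc n)" using step.prems assms(1) by blast+
      then obtain k where k: "k \<ge> Suc n" "B k" "\<forall>i. Suc n \<le> i \<and> i < k \<longrightarrow> A i"
        using step.IH step.prems by blast
      have "A i" if "n \<le> i" "i < k" for i
        using that k(3) \<open>A n\<close> by (cases "i = n") auto
      then show ?thesis using k(1,2) Suc_leD by blast
    qed auto
  qed auto
next
  assume "\<exists>m\<ge>n. B m \<and> (\<forall>i. n \<le> i \<and> i < m \<longrightarrow> A i)"
  then obtain m where m: "m \<ge> n" "B m" "\<And>i. n \<le> i \<Longrightarrow> i < m \<Longrightarrow> A i" by blast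
  from m(1) show "P n"
  proof (induction rule: inc_induct)
    case base
    then show ?case using m(2) assms(1) by blast
  next
    case (step k)
    then show ?case using m(3) assms(1) by blast
  qed
qed

lemma greatest_solution:
  assumes "\<And>n. P n \<longleftrightarrow> B n \<or> A n \<and> P (Suc n)" and "\<And>n. \<exists>m\<ge>n. A m \<longrightarrow> P m"
  shows "P n \<longleftrightarrow> (\<exists>m\<ge>n. B m \<and> (\<forall>i. n \<le> i \<and> i < m \<longrightarrow> A i)) \<or> (\<forall>m\<ge>n. A m)"
proof -
  \<comment> \<open>The complement of a weak until is an until.\<close>
  have "(\<not> P n) \<longleftrightarrow>
      (\<exists>m\<ge>n. (\<not> A m \<and> \<not> B m) \<and> (\<forall>i. n \<le> i \<and> i < m \<longrightarrow> \<not> B i))"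
  proof (rule least_solution[of "\<lambda>n. \<not> P n"])
    show "(\<not> P n) \<longleftrightarrow> (\<not> A n \<and> \<not> B n) \<or> \<not> B n \<and> \<not> P (Suc n)" for n
      using assms(1) by blast
    \<comment> \<open>The recurrence excludes A at m; the fixpoint equation itself excludes B
      wherever P fails.\<close>
    show "\<exists>m\<ge>n. \<not> P m \<longrightarrow> \<not> A m \<and> \<not> B m" for n
      using assms by blast
  qed
  moreover have "(\<exists>m\<ge>n. (\<not> A m \<and> \<not> B m) \<and> (\<forall>i. n \<le> i \<and> i < m \<longrightarrow> \<not> B i)) \<longleftrightarrow>
      \<not> ((\<exists>m\<ge>n. B m \<and> (\<forall>i. n \<le> i \<and> i < m \<longrightarrow> A i)) \<or> (\<forall>m\<ge>n. A m))" (is "?l \<longleftrightarrow> \<not> ?r")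
  proof
    assume ?l
    then obtain m where m: "m \<ge> n" "\<not> A m" "\<not> B m" "\<And>i. n \<le> i \<Longrightarrow> i < m \<Longrightarrow> \<not> B i" by blast
    have False if "k \<ge> n" "B k" "\<forall>i. n \<le> i \<and> i < k \<longrightarrow> A i" for k
      using m that by (metis linorder_neqE_nat)
    then show "\<not> ?r" using m by blast
  next
    assume r: "\<not> ?r"
    then obtain k where k: "k \<ge> n \<and> \<not> A k" by blast
    \<comment> \<open>The first failure of A: since A holds before it, an occurrence of B up to and
      including m would fulfil the until.\<close>
    define m where "m = (LEAST k. k \<ge> n \<and> \<not> A k)"
    have m: "m \<ge> n" "\<not> A m" using LeastI[of "\<lambda>k. k \<ge> n \<and> \<not> A k", OF k] by (simp_all add: m_def)
    have "A i" if "n \<le> i" "i < m" for i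
      using not_less_Least[of i "\<lambda>k. k \<ge> n \<and> \<not> A k"] that by (auto simp: m_def)
    then have "\<not> B i" if "n \<le> i" "i \<le> m" for i using r that by fastforce
    then show ?l using m by auto
  qed
  ultimately show ?thesis by blast
qed

lemma until_unfold:
  "holds M n a (Until A B) \<longleftrightarrow>
     holds M n a B \<or> holds M n a A \<and> holds M (Suc n) a (Until A B)" (is "?l \<longleftrightarrow> ?r")
proof
  assume ?l
  then obtain m where m: "m \<ge> n" "holds M m a B" "\<forall>i. n \<le> i \<and> i < m \<longrightarrow> holds M i a A" by auto
  then show ?r by (cases "m = n") (auto intro!: exI[of _ m])
next
  assume ?r
  then show ?l
  proof
    assume "holds M n a A \<and> holds M (Suc n) a (Until A B)"
    then obtain m where m: "holds M n a A" "m \<ge> Suc n" "holds M m a B"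
        "\<forall>i. Suc n \<le> i \<and> i < m \<longrightarrow> holds M i a A" by auto
    have "holds M i a A" if "n \<le> i" "i < m" for i using m that by (cases "i = n") auto
    then have "\<forall>i. n \<le> i \<and> i < m \<longrightarrow> holds M i a A" by blast
    then show ?l using m(2,3) Suc_leD by (simp, blast)
  qed auto
qed

lemma wuntil_unfold:
  "holds M n a (WUntil A B) \<longleftrightarrow>
     holds M n a B \<or> holds M n a A \<and> holds M (Suc n) a (WUntil A B)"
proof -
  have W: "holds M k a (WUntil A B) \<longleftrightarrow> holds M k a (Until A B) \<or> (\<forall>m\<ge>k. holds M m a A)" for k
    by simp
  have "(\<forall>m\<ge>n. holds M m a A) \<longleftrightarrow> holds M n a A \<and> (\<forall>m\<ge>Suc n. holds M m a A)"
    by (metis Suc_leD le_refl not_less_eq_eq order_antisym)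
  then show ?thesis unfolding W using until_unfold[of M n a A B] by blast
qed

section \<open>From a model of the formula to a model of its normal form\<close>

fun now :: "fm \<Rightarrow> fm" where
  "now (Next A) = A"
| "now A = A"

text \<open>\<open>Top\<close> for a next-time formula makes the eventuality of its index trivially
  true.\<close>

fun goal :: "fm \<Rightarrow> fm" where
  "goal (Sometime A) = Imp (Sometime A) A"
| "goal (Always A) = Imp A (Always A)"
| "goal (Until A B) = Imp (Until A B) B"
| "goal (WUntil A B) = Imp A (WUntil A B)"
| "goal _ = Top"

fun named_arg :: "fm \<Rightarrow> fm" where
  "named_arg (Sometime A) = A"
| "named_arg (Always A) = A"
| "named_arg (Until A B) = B"
| "named_arg (WUntil A B) = A"
| "named_arg A = A"

definition meaning :: "nat \<Rightarrow> fm \<Rightarrow> fm" where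
  "meaning r A = (if r = 0 then now A else if r = 1 then Next (now A)
     else if r = 2 then goal A else named_arg A)"

text \<open>The names are decoded by \<open>mod\<close> and \<open>div\<close>. A constant
  assignment suffices to interpret them, since a monodic temporal formula depends on at most one
  value. On longer lists \<open>drop 2\<close> removes the padding of the atoms.\<close>

definition expand :: "(nat \<Rightarrow> fm) \<Rightarrow> 'd tstruct \<Rightarrow> 'd tstruct" where
  "expand N M = M\<lparr>trel := \<lambda>n p ds. case ds of
       [d] \<Rightarrow> holds M n (\<lambda>_. d) (meaning (p mod 4) (N (p div 4)))
     | _ \<Rightarrow> trel M n p (drop 2 ds)\<rparr>"

lemma tdom_expand [simp]: "tdom (expand N M) = tdom M"
  by (simp add: expand_def)

lemma eval_tm_expand [simp]: "eval_tm (expand N M) = eval_tm M"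
proof (intro ext)
  show "eval_tm (expand N M) a t = eval_tm M a t" for a t by (cases t) (simp_all add: expand_def)
qed

lemma holds_aux_expand:
  "r < 4 \<Longrightarrow> holds (expand N M) n a (aux r j t) \<longleftrightarrow>
     holds M n (\<lambda>_. eval_tm M a t) (meaning r (N j))"
  by (simp add: aux_def) (simp add: expand_def)

lemma holds_anchor_tm:
  assumes "card (fv A) \<le> 1"
  shows "holds M n (\<lambda>_. eval_tm M a (anchor_tm A)) A \<longleftrightarrow> holds M n a A"
proof (rule holds_cong)
  fix x assume x: "x \<in> fv A"
  then have "x = anchor_var A" "fvs A \<noteq> []" using fv_anchor_var[OF assms] set_fvs[of A] by auto
  then show "eval_tm M a (anchor_tm A) = a x"
    by (cases "fvs A") (auto simp: anchor_tm_def anchor_var_def)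
qed

lemma holds_const_asg:
  assumes "fv A \<subseteq> {y}"
  shows "holds M n (\<lambda>_. d) A \<longleftrightarrow> holds M n (a(y := d)) A"
  using assms by (intro holds_cong) auto

text \<open>A single numbering \<open>N\<close> of the whole formula is kept throughout the
  inductions; passing to a subformula only moves the window starting at \<open>j\<close>.\<close>

definition agrees :: "(nat \<Rightarrow> fm) \<Rightarrow> nat \<Rightarrow> fm list \<Rightarrow> bool" where
  "agrees N j As \<longleftrightarrow> (\<forall>k<length As. N (j + k) = As ! k)"

lemma agrees_Cons [simp]: "agrees N j (A # As) \<longleftrightarrow> N j = A \<and> agrees N (Suc j) As"
  by (simp add: agrees_def All_less_Suc2)

lemma agrees_append [simp]:
  "agrees N j (As @ Bs) \<longleftrightarrow> agrees N j As \<and> agrees N (length As + j) Bs"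
  unfolding agrees_def
proof (intro iffI conjI allI impI)
  fix k assume *: "\<forall>k<length (As @ Bs). N (j + k) = (As @ Bs) ! k"
  show "N (j + k) = As ! k" if "k < length As" using *[rule_format, of k] that by (simp add: nth_append)
  show "N (length As + j + k) = Bs ! k" if "k < length Bs"
    using *[rule_format, of "length As + k"] that by (simp add: nth_append ac_simps)
next
  fix k assume *: "(\<forall>k<length As. N (j + k) = As ! k) \<and> (\<forall>k<length Bs. N (length As + j + k) = Bs ! k)"
    and k: "k < length (As @ Bs)"
  show "N (j + k) = (As @ Bs) ! k"
  proof (cases "k < length As")
    case False
    then show ?thesis using * k
      by (auto simp: nth_append dest!: spec[of _ "k - length As"])
  qed (use * in \<open>simp add: nth_append\<close>)
qed

text \<open>The temporal cases do not descend: the atom means the subformula by construction of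
  \<open>expand\<close>.\<close>

lemma holds_flat_expand:
  "monodic A \<Longrightarrow> agrees N j (temporals A) \<Longrightarrow>
     holds (expand N M) n a (flat A j) \<longleftrightarrow> holds M n a A"
proof (induction A arbitrary: j n a)
  case (Pred p ts)
  show ?case by simp (simp add: expand_def)
next
  case (Next A)
  then show ?case
    using holds_anchor_tm[of "Next A" M n a] by (simp add: holds_aux_expand meaning_def)
next
  case (Sometime A)
  then show ?case
    using holds_anchor_tm[of "Sometime A" M n a] by (simp add: holds_aux_expand meaning_def)
next
  case (Always A)
  then show ?case
    using holds_anchor_tm[of "Always A" M n a] by (simp add: holds_aux_expand meaning_def)
next
  case (Until A B)
  then show ?case
    using holds_anchor_tm[of "Until A B" M n a] by (simp add: holds_aux_expand meaning_def)
next
  case (WUntil A B)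
  then show ?case
    using holds_anchor_tm[of "WUntil A B" M n a] by (simp add: holds_aux_expand meaning_def)
qed auto

lemma holds_until_def:
  "holds M n a (until_def y j A B) \<longleftrightarrow> (\<forall>d\<in>tdom M. let b = a(y := d); t = Var y in
     (holds M n b (aux 3 j t) \<longleftrightarrow> holds M n b B) \<and>
     (holds M n b (aux 0 j t) \<longleftrightarrow> holds M n b B \<or> holds M n b A \<and> holds M n b (aux 1 j t)) \<and>
     (holds M n b (aux 2 j t) \<longleftrightarrow> (holds M n b (aux 0 j t) \<longrightarrow> holds M n b B)))"
  by (auto simp: until_def_def Let_def)

lemma holds_wuntil_def:
  "holds M n a (wuntil_def y j A B) \<longleftrightarrow> (\<forall>d\<in>tdom M. let b = a(y := d); t = Var y in
     (holds M n b (aux 3 j t) \<longleftrightarrow> holds M n b A) \<and>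
     (holds M n b (aux 0 j t) \<longleftrightarrow> holds M n b B \<or> holds M n b A \<and> holds M n b (aux 1 j t)) \<and>
     (holds M n b (aux 2 j t) \<longleftrightarrow> (holds M n b A \<longrightarrow> holds M n b (aux 0 j t))))"
  by (auto simp: wuntil_def_def Let_def)

lemma holds_defs_expand:
  "monodic A \<Longrightarrow> agrees N j (temporals A) \<Longrightarrow> U \<in> set (defs A j) \<Longrightarrow> holds (expand N M) n a U"
proof (induction A arbitrary: j)
  case (Next A)
  let ?y = "anchor_var (Next A)"
  have y: "fv A \<subseteq> {?y}" using Next.prems(1) fv_anchor_var[of "Next A"] by simp
  have "holds (expand N M) n a (next_def ?y j (flat A (Suc j)))"
    using Next.prems holds_const_asg[OF y, of M _ _ a]
    by (simp add: next_def_def holds_aux_expand meaning_def holds_flat_expand)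
  then show ?case using Next by auto
next
  case (Sometime A)
  let ?y = "anchor_var (Sometime A)"
  have y: "fv A \<subseteq> {?y}" using Sometime.prems(1) fv_anchor_var[of "Sometime A"] by simp
  have "holds (expand N M) n a (until_def ?y j Top (flat A (Suc j)))"
    using Sometime.prems holds_const_asg[OF y, of M _ _ a] until_unfold[of M n _ Top A]
    by (simp add: holds_until_def Let_def holds_aux_expand meaning_def holds_flat_expand)
  then show ?case using Sometime by auto
next
  case (Always A)
  let ?y = "anchor_var (Always A)"
  have y: "fv A \<subseteq> {?y}" using Always.prems(1) fv_anchor_var[of "Always A"] by simp
  have "holds (expand N M) n a (wuntil_def ?y j (flat A (Suc j)) Bot)"
    using Always.prems holds_const_asg[OF y, of M _ _ a] wuntil_unfold[of M n _ A Bot]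
    by (simp add: holds_wuntil_def Let_def holds_aux_expand meaning_def holds_flat_expand)
  then show ?case using Always by auto
next
  case (Until A B)
  let ?y = "anchor_var (Until A B)"
  have y: "fv A \<subseteq> {?y}" "fv B \<subseteq> {?y}"
    using Until.prems(1) fv_anchor_var[of "Until A B"] by simp_all
  have "holds (expand N M) n a (until_def ?y j (flat A (Suc j)) (flat B (ntemp A + Suc j)))"
    using Until.prems until_unfold[of M n _ A B]
      holds_const_asg[OF y(1), of M _ _ a] holds_const_asg[OF y(2), of M _ _ a]
    by (simp add: holds_until_def Let_def holds_aux_expand meaning_def holds_flat_expand
        del: holds.simps(14))
  then show ?case using Until by auto
next
  case (WUntil A B)
  let ?y = "anchor_var (WUntil A B)"
  have y: "fv A \<subseteq> {?y}" "fv B \<subseteq> {?y}"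
    using WUntil.prems(1) fv_anchor_var[of "WUntil A B"] by simp_all
  have "holds (expand N M) n a (wuntil_def ?y j (flat A (Suc j)) (flat B (ntemp A + Suc j)))"
    using WUntil.prems wuntil_unfold[of M n _ A B]
      holds_const_asg[OF y(1), of M _ _ a] holds_const_asg[OF y(2), of M _ _ a]
    by (simp add: holds_wuntil_def Let_def holds_aux_expand meaning_def holds_flat_expand
        del: holds.simps(15))
  then show ?case using WUntil by auto
qed auto

text \<open>For until and sometime: if the formula fails at n, n itself will do, otherwise the time
  that fulfils it. For weak until and always: a time at which the first argument fails, or n if
  there is none.\<close>

lemma goal_recurs: "\<exists>m\<ge>n. holds M m a (goal A)"
proof (cases A)
  case (Sometime B)
  then show ?thesis by (cases "holds M n a A") auto
next
  case (Always B)
  then show ?thesis by (cases "\<forall>m\<ge>n. holds M m a B") (auto, blast?)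
next
  case (Until B C)
  then show ?thesis by (cases "holds M n a A") auto
next
  case (WUntil B C)
  then show ?thesis by (cases "\<forall>m\<ge>n. holds M m a B") (auto, blast?)
qed auto

section \<open>From a model of the normal form back to a model of the formula\<close>

definition contract :: "'d tstruct \<Rightarrow> 'd tstruct" where
  "contract M = M\<lparr>trel := \<lambda>n p ds. trel M n p (tcon M 0 # tcon M 0 # ds)\<rparr>"

lemma tdom_contract [simp]: "tdom (contract M) = tdom M"
  by (simp add: contract_def)

lemma eval_tm_contract [simp]: "eval_tm (contract M) = eval_tm M"
proof (intro ext)
  show "eval_tm (contract M) a t = eval_tm M a t" for a t by (cases t) (simp_all add: contract_def)
qed

lemma assignment_upd: "assignment M a \<Longrightarrow> d \<in> tdom M \<Longrightarrow> assignment M (a(y := d))"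
  by (auto simp: assignment_def)

lemma eval_tm_in_tdom: "tstructure M \<Longrightarrow> assignment M a \<Longrightarrow> eval_tm M a t \<in> tdom M"
  by (cases t) (auto simp: tstructure_def assignment_def)

text \<open>The update restores the value of the only free variable, or changes a variable that does
  not occur. It links a definition, instantiated at the anchor's value, with the formula under
  \<open>a\<close>.\<close>

lemma holds_anchor_upd:
  "card (fv A) \<le> 1 \<Longrightarrow>
     holds M n (a(anchor_var A := eval_tm M a (anchor_tm A))) A \<longleftrightarrow> holds M n a A"
  using holds_anchor_tm[of A M n a] holds_const_asg[OF fv_anchor_var, of A M n _ a] by simp

lemma until_def_solution:
  assumes "\<And>n. holds M n a (until_def y j A B)" and d: "d \<in> tdom M"
    and "\<And>n. trel M n (4 * j + 1) [d] \<longleftrightarrow> trel M (Suc n) (4 * j) [d]"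
    and "\<And>n. \<exists>m\<ge>n. trel M m (4 * j + 2) [d]"
  shows "trel M n (4 * j) [d] \<longleftrightarrow> holds M n (a(y := d)) (Until A B)"
proof -
  have *: "(trel M n (4 * j) [d] \<longleftrightarrow> holds M n (a(y := d)) B \<or>
        holds M n (a(y := d)) A \<and> trel M (Suc n) (4 * j) [d]) \<and>
      (trel M n (4 * j + 2) [d] \<longleftrightarrow> (trel M n (4 * j) [d] \<longrightarrow> holds M n (a(y := d)) B))" for n
    using assms(1)[of n] d assms(3)[of n] by (auto simp: holds_until_def aux_def Let_def)
  show ?thesis
    unfolding holds.simps using * assms(4) by (intro least_solution) blast+
qed

lemma wuntil_def_solution:
  assumes "\<And>n. holds M n a (wuntil_def y j A B)" and d: "d \<in> tdom M"
    and "\<And>n. trel M n (4 * j + 1) [d] \<longleftrightarrow> trel M (Suc n) (4 * j) [d]"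
    and "\<And>n. \<exists>m\<ge>n. trel M m (4 * j + 2) [d]"
  shows "trel M n (4 * j) [d] \<longleftrightarrow> holds M n (a(y := d)) (WUntil A B)"
proof -
  have *: "(trel M n (4 * j) [d] \<longleftrightarrow> holds M n (a(y := d)) B \<or>
        holds M n (a(y := d)) A \<and> trel M (Suc n) (4 * j) [d]) \<and>
      (trel M n (4 * j + 2) [d] \<longleftrightarrow> (holds M n (a(y := d)) A \<longrightarrow> trel M n (4 * j) [d]))" for n
    using assms(1)[of n] d assms(3)[of n] by (auto simp: holds_wuntil_def aux_def Let_def)
  show ?thesis
    unfolding holds.simps using * assms(4) by (intro greatest_solution) blast+
qed

text \<open>In an arbitrary model the names are pinned down by definitions and clauses only, so here
  the induction does pass through the arguments, at all times. \<open>K\<close> is the total number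
  of indices; the bound on \<open>j + ntemp A\<close> puts each index met below it.\<close>

lemma holds_flat_contract:
  assumes M: "tstructure M"
    and step: "\<And>k n d. k < K \<Longrightarrow> d \<in> tdom M \<Longrightarrow>
      trel M n (4 * k + 1) [d] \<longleftrightarrow> trel M (Suc n) (4 * k) [d]"
    and ev: "\<And>k n d. k < K \<Longrightarrow> d \<in> tdom M \<Longrightarrow> \<exists>m\<ge>n. trel M m (4 * k + 2) [d]"
  shows "monodic A \<Longrightarrow> j + ntemp A \<le> K \<Longrightarrow>
     (\<And>U n a. U \<in> set (defs A j) \<Longrightarrow> assignment M a \<Longrightarrow> holds M n a U) \<Longrightarrow> assignment M a \<Longrightarrow>
     holds M n a (flat A j) \<longleftrightarrow> holds (contract M) n a A"
proof (induction A arbitrary: j n a)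
  case (Pred p ts)
  show ?case by simp (simp add: contract_def)
next
  case (Forall x A)
  then show ?case by (auto simp: assignment_upd)
next
  case (Exists x A)
  then show ?case by (auto simp: assignment_upd)
next
  case (Next A)
  \<comment> \<open>\<open>e\<close> is the element to which \<open>flat\<close> applies the name,
    \<open>b\<close> the assignment under which the definition speaks of \<open>e\<close>.\<close>
  define e b where "e = eval_tm M a (anchor_tm (Next A))" and "b = a(anchor_var (Next A) := e)"
  have e: "e \<in> tdom M" unfolding e_def using M Next.prems(4) by (rule eval_tm_in_tdom)
  have b: "assignment M b" unfolding b_def using Next.prems(4) e by (rule assignment_upd)
  have "trel M n (4 * j) [e] \<longleftrightarrow> holds M n b (flat A (Suc j))" for n
    using Next.prems(3)[of "next_def (anchor_var (Next A)) j (flat A (Suc j))" a n] e Next.prems(4)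
    by (simp add: next_def_def aux_def b_def)
  moreover have "holds M n b (flat A (Suc j)) \<longleftrightarrow> holds (contract M) n b A" for n
    using Next.prems b by (intro Next.IH) auto
  moreover have "trel M n (4 * j + 1) [e] \<longleftrightarrow> trel M (Suc n) (4 * j) [e]"
    using Next.prems(2) e by (intro step) auto
  moreover have "holds (contract M) n b (Next A) \<longleftrightarrow> holds (contract M) n a (Next A)"
    using holds_anchor_upd[of "Next A" "contract M" n a] Next.prems(1) by (simp add: b_def e_def)
  ultimately show ?case by (simp add: aux_def e_def)
next
  case (Sometime A)
  define e b where "e = eval_tm M a (anchor_tm (Sometime A))"
    and "b = a(anchor_var (Sometime A) := e)"
  have e: "e \<in> tdom M" unfolding e_def using M Sometime.prems(4) by (rule eval_tm_in_tdom)
  have b: "assignment M b" unfolding b_def using Sometime.prems(4) e by (rule assignment_upd)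
  have "trel M n (4 * j) [e] \<longleftrightarrow> holds M n b (Until Top (flat A (Suc j)))"
    unfolding b_def using Sometime.prems e by (intro until_def_solution step ev) auto
  moreover have "holds M n b (flat A (Suc j)) \<longleftrightarrow> holds (contract M) n b A" for n
    using Sometime.prems b by (intro Sometime.IH) auto
  moreover have "holds (contract M) n b (Sometime A) \<longleftrightarrow> holds (contract M) n a (Sometime A)"
    using holds_anchor_upd[of "Sometime A" "contract M" n a] Sometime.prems(1)
    by (simp add: b_def e_def)
  ultimately show ?case by (simp add: aux_def e_def)
next
  case (Always A)
  define e b where "e = eval_tm M a (anchor_tm (Always A))"
    and "b = a(anchor_var (Always A) := e)"
  have e: "e \<in> tdom M" unfolding e_def using M Always.prems(4) by (rule eval_tm_in_tdom)
  have b: "assignment M b" unfolding b_def using Always.prems(4) e by (rule assignment_upd)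
  have "trel M n (4 * j) [e] \<longleftrightarrow> holds M n b (WUntil (flat A (Suc j)) Bot)"
    unfolding b_def using Always.prems e by (intro wuntil_def_solution step ev) auto
  moreover have "holds M n b (flat A (Suc j)) \<longleftrightarrow> holds (contract M) n b A" for n
    using Always.prems b by (intro Always.IH) auto
  moreover have "holds (contract M) n b (Always A) \<longleftrightarrow> holds (contract M) n a (Always A)"
    using holds_anchor_upd[of "Always A" "contract M" n a] Always.prems(1)
    by (simp add: b_def e_def)
  ultimately show ?case by (simp add: aux_def e_def)
next
  case (Until A B)
  let ?B = "flat B (ntemp A + Suc j)"
  define e b where "e = eval_tm M a (anchor_tm (Until A B))"
    and "b = a(anchor_var (Until A B) := e)"
  have e: "e \<in> tdom M" unfolding e_def using M Until.prems(4) by (rule eval_tm_in_tdom)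
  have b: "assignment M b" unfolding b_def using Until.prems(4) e by (rule assignment_upd)
  have "trel M n (4 * j) [e] \<longleftrightarrow> holds M n b (Until (flat A (Suc j)) ?B)"
    unfolding b_def using Until.prems e by (intro until_def_solution step ev) auto
  moreover have "holds M n b (flat A (Suc j)) \<longleftrightarrow> holds (contract M) n b A" for n
    using Until.prems b by (intro Until.IH) auto
  moreover have "holds M n b ?B \<longleftrightarrow> holds (contract M) n b B" for n
    using Until.prems b by (intro Until.IH) auto
  moreover have "holds (contract M) n b (Until A B) \<longleftrightarrow> holds (contract M) n a (Until A B)"
    using holds_anchor_upd[of "Until A B" "contract M" n a] Until.prems(1)
    by (simp add: b_def e_def)
  ultimately show ?case by (simp add: aux_def e_def)
next
  case (WUntil A B)
  let ?B = "flat B (ntemp A + Suc j)"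
  define e b where "e = eval_tm M a (anchor_tm (WUntil A B))"
    and "b = a(anchor_var (WUntil A B) := e)"
  have e: "e \<in> tdom M" unfolding e_def using M WUntil.prems(4) by (rule eval_tm_in_tdom)
  have b: "assignment M b" unfolding b_def using WUntil.prems(4) e by (rule assignment_upd)
  have "trel M n (4 * j) [e] \<longleftrightarrow> holds M n b (WUntil (flat A (Suc j)) ?B)"
    unfolding b_def using WUntil.prems e by (intro wuntil_def_solution step ev) auto
  moreover have "holds M n b (flat A (Suc j)) \<longleftrightarrow> holds (contract M) n b A" for n
    using WUntil.prems b by (intro WUntil.IH) auto
  moreover have "holds M n b ?B \<longleftrightarrow> holds (contract M) n b B" for n
    using WUntil.prems b by (intro WUntil.IH) auto
  moreover have "holds (contract M) n b (WUntil A B) \<longleftrightarrow> holds (contract M) n a (WUntil A B)"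
    using holds_anchor_upd[of "WUntil A B" "contract M" n a] WUntil.prems(1)
    by (simp add: b_def e_def)
  ultimately show ?case by (simp add: aux_def e_def)
qed auto

lemma holds_conj_list: "holds M n a (conj_list As) \<longleftrightarrow> (\<forall>A\<in>set As. holds M n a A)"
  by (induction As) auto

lemma holds_foldr_Exists:
  assumes "assignment M a" "holds M n a A"
  shows "holds M n a (foldr Exists xs A)"
proof (induction xs)
  case (Cons x xs)
  moreover have "a x \<in> tdom M" using assms(1) by (auto simp: assignment_def)
  ultimately show ?case by (auto intro!: bexI[of _ "a x"])
qed (simp add: assms)

lemma holds_foldr_ExistsD:
  "assignment M a \<Longrightarrow> holds M n a (foldr Exists xs A) \<Longrightarrow> \<exists>b. assignment M b \<and> holds M n b A"
  by (induction xs arbitrary: a) (auto dest: assignment_upd)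

text \<open>The clause between negative literals is the contrapositive of the converse of the
  positive one.\<close>

lemma holds_steps:
  "(\<forall>s\<in>set (steps K). holds M n (a(0 := d)) (step_fm s)) \<longleftrightarrow>
     (\<forall>k<K. trel M n (4 * k + 1) [d] \<longleftrightarrow> trel M (Suc n) (4 * k) [d])"
  by (induction K) (auto simp: step_fm_def less_Suc_eq)

lemma holds_evs:
  "(\<forall>e\<in>set (evs K). holds M n (a(0 := d)) (ev_fm e)) \<longleftrightarrow>
     (\<forall>k<K. \<exists>m\<ge>n. trel M m (4 * k + 2) [d])"
  by (induction K) (auto simp: less_Suc_eq)

lemma holds_problem_fm_to_dsnf:
  "holds M 0 a (problem_fm (to_dsnf A)) \<longleftrightarrow>
     holds M 0 a (foldr Exists (fvs A) (flat A 0)) \<and>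
     (\<forall>n. \<forall>U\<in>set (defs A 0). holds M n a U) \<and>
     (\<forall>k<ntemp A. \<forall>n. \<forall>d\<in>tdom M.
        (trel M n (4 * k + 1) [d] \<longleftrightarrow> trel M (Suc n) (4 * k) [d]) \<and>
        (\<exists>m\<ge>n. trel M m (4 * k + 2) [d]))"
  by (simp only: problem_fm_def to_dsnf_def problem.simps holds.simps holds_conj_list set_map
      ball_simps holds_steps holds_evs) auto

lemma satisfiable_to_dsnf:
  assumes "monodic A"
  shows "satisfiable A \<longleftrightarrow> satisfiable (problem_fm (to_dsnf A))"
proof
  assume "satisfiable A"
  then obtain M :: "nat tstruct" and a where M: "tstructure M" "assignment M a" "holds M 0 a A"
    by (auto simp: satisfiable_def)
  define N where "N k = temporals A ! k" for k
  have N: "agrees N 0 (temporals A)" by (simp add: agrees_def N_def)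
  let ?M = "expand N M"
  have M': "tstructure ?M" "assignment ?M a"
    using M by (simp_all add: tstructure_def assignment_def) (simp add: expand_def)
  have "holds ?M 0 a (flat A 0)"
    using holds_flat_expand[OF assms N] M(3) by blast
  with M'(2) have "holds ?M 0 a (foldr Exists (fvs A) (flat A 0))" by (rule holds_foldr_Exists)
  moreover have "trel ?M n (4 * k + r) [d] \<longleftrightarrow> holds M n (\<lambda>_. d) (meaning r (N k))"
    if "r < 4" for n k r d
    using holds_aux_expand[OF that, of N M n "\<lambda>_. d" k "Var 0"] by (simp add: aux_def)
  from this[of 0] this[of 1] this[of 2]
  \<comment> \<open>This holds for every k, even beyond the list: role 1 means next of role 0 and
    goals recur, whatever formula \<open>N k\<close> is.\<close>
  have "(trel ?M n (4 * k + 1) [d] \<longleftrightarrow> trel ?M (Suc n) (4 * k) [d]) \<and>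
      (\<exists>m\<ge>n. trel ?M m (4 * k + 2) [d])" for n k d
    using goal_recurs by (simp add: meaning_def)
  ultimately have "holds ?M 0 a (problem_fm (to_dsnf A))"
    using holds_defs_expand[OF assms N] unfolding holds_problem_fm_to_dsnf by blast
  with M' show "satisfiable (problem_fm (to_dsnf A))" unfolding satisfiable_def by blast
next
  assume "satisfiable (problem_fm (to_dsnf A))"
  then obtain M :: "nat tstruct" and a where M: "tstructure M" "assignment M a"
    and h: "holds M 0 a (problem_fm (to_dsnf A))"
    by (auto simp: satisfiable_def)
  note h = h[unfolded holds_problem_fm_to_dsnf]
  obtain b where b: "assignment M b" "holds M 0 b (flat A 0)"
    using holds_foldr_ExistsD M(2) h by blast
  \<comment> \<open>Definitions are closed, so their truth under \<open>a\<close> carries over to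
    every assignment.\<close>
  have "holds M n c U" if "U \<in> set (defs A 0)" for U n c
    using h that holds_cong[of U c a M n] fv_defs[OF assms that] by simp
  then have "holds M 0 b (flat A 0) \<longleftrightarrow> holds (contract M) 0 b A"
    using h assms b(1) by (intro holds_flat_contract[OF M(1), of "ntemp A"]) simp_all
  moreover have "tstructure (contract M)" "assignment (contract M) b"
    using M(1) b(1) by (simp_all add: tstructure_def assignment_def) (simp add: contract_def)
  ultimately show "satisfiable A" using b(2) unfolding satisfiable_def by blast
qed

section \<open>A program for the translation\<close>

text \<open>
  Evaluation is deterministic, so a correct run can be stated as an equivalence
  \<open>evaluates prog args e v \<longleftrightarrow> v = w\<close>; the simplifier then executes programs by rewriting.
\<close>

lemma evaluates_iff:
  "evaluates prog args e w \<Longrightarrow> evaluates prog args e v \<longleftrightarrow> v = w"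
  using evaluates_deterministic by blast

lemma evaluates_simps:
  "evaluates prog args (ArgE i) v \<longleftrightarrow> i < length args \<and> v = args ! i"
  "evaluates prog args LfE v \<longleftrightarrow> v = Lf"
  "evaluates prog args (BrE e1 e2) v \<longleftrightarrow>
     (\<exists>v1 v2. evaluates prog args e1 v1 \<and> evaluates prog args e2 v2 \<and> v = Br v1 v2)"
  "evaluates prog args (HeadE e) v \<longleftrightarrow> (\<exists>w. evaluates prog args e (Br v w))"
  "evaluates prog args (TailE e) v \<longleftrightarrow> (\<exists>w. evaluates prog args e (Br w v))"
  "evaluates prog args (IfE e e1 e2) v \<longleftrightarrow>
     (\<exists>w1 w2. evaluates prog args e (Br w1 w2)) \<and> evaluates prog args e1 v \<or>
     evaluates prog args e Lf \<and> evaluates prog args e2 v"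
  "evaluates prog args (CallE i es) v \<longleftrightarrow>
     (\<exists>vs. list_all2 (evaluates prog args) es vs \<and> i < length prog \<and>
        evaluates prog vs (prog ! i) v)"
  by (rule iffI, erule evaluates.cases, (blast intro: evaluates.intros)+)+

definition sucs :: "nat \<Rightarrow> bt \<Rightarrow> bt" where
  "sucs k v = (Br Lf ^^ k) v"

text \<open>Apart from 0, only equations with codes are rewritten; constructor numbers stay folded,
  as case distinction on them requires.\<close>

lemma nat_code_simps:
  "nat_code 0 = Lf"
  "nat_code n = Lf \<longleftrightarrow> n = 0" "Lf = nat_code n \<longleftrightarrow> n = 0"
  "nat_code (Suc n) = Br v w \<longleftrightarrow> v = Lf \<and> w = nat_code n"
  "Br v w = nat_code (Suc n) \<longleftrightarrow> v = Lf \<and> w = nat_code n"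
proof -
  show "nat_code n = Lf \<longleftrightarrow> n = 0" "Lf = nat_code n \<longleftrightarrow> n = 0"
    by (cases n; simp add: nat_code_def)+
qed (auto simp: nat_code_def)

lemma sucs_nat_code: "sucs k (nat_code n) = nat_code (n + k)"
  by (induction k) (simp_all add: sucs_def nat_code_def)

section \<open>Derived program constructs\<close>

primrec listE :: "expr list \<Rightarrow> expr" where
  "listE [] = LfE"
| "listE (e # es) = BrE e (listE es)"

definition sucE :: "nat \<Rightarrow> expr \<Rightarrow> expr" where
  "sucE k e = (BrE LfE ^^ k) e"

definition nodeE :: "nat \<Rightarrow> expr list \<Rightarrow> expr" where
  "nodeE k es = BrE (sucE k LfE) (listE es)"

text \<open>Case distinction on a unary number: each \<open>IfE\<close> strips one leaf, so the
  value k of \<open>t\<close> selects entry k.\<close>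

primrec branchE :: "expr \<Rightarrow> expr list \<Rightarrow> expr" where
  "branchE t [] = LfE"
| "branchE t (e # es) = IfE t (branchE (TailE t) es) e"

definition switchE :: "expr list \<Rightarrow> expr" where
  "switchE es = branchE (HeadE (ArgE 0)) es"

abbreviation sub0 :: expr where "sub0 \<equiv> HeadE (TailE (ArgE 0))"
abbreviation sub1 :: expr where "sub1 \<equiv> HeadE (TailE (TailE (ArgE 0)))"

lemma evaluates_sucE:
  "evaluates prog args (sucE k e) v \<longleftrightarrow> (\<exists>w. evaluates prog args e w \<and> v = sucs k w)"
  by (induction k arbitrary: v) (auto simp: sucE_def sucs_def evaluates_simps)

lemma evaluates_nodeE:
  "evaluates prog args (nodeE k es) v \<longleftrightarrow>
     (\<exists>w. evaluates prog args (listE es) w \<and> v = Br (nat_code k) w)"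
  using sucs_nat_code[of k 0]
  by (auto simp: nodeE_def evaluates_simps evaluates_sucE nat_code_simps)

lemma evaluates_branchE:
  "k < length es \<Longrightarrow> evaluates prog args t (nat_code k) \<Longrightarrow>
     evaluates prog args (branchE t es) v \<longleftrightarrow> evaluates prog args (es ! k) v"
proof (induction es arbitrary: t k)
  case (Cons e es)
  show ?case
  proof (cases k)
    case 0
    then show ?thesis
      using evaluates_iff[OF Cons.prems(2)] by (simp add: evaluates_simps nat_code_simps)
  next
    case (Suc m)
    then have "evaluates prog args (TailE t) (nat_code m)"
      using evaluates_iff[OF Cons.prems(2)] by (auto simp: evaluates_simps nat_code_simps)
    then show ?thesis
      using Cons.IH[of m "TailE t"] Cons.prems Suc evaluates_iff[OF Cons.prems(2)]
      by (simp add: evaluates_simps nat_code_simps)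
  qed
qed simp

text \<open>Constructor 0 needs its own rule, since the simplifier turns \<open>nat_code 0\<close>
  into \<open>Lf\<close>.\<close>

lemma evaluates_switchE:
  "k < length es \<Longrightarrow> evaluates prog (Br (nat_code k) w # args) (switchE es) v \<longleftrightarrow>
     evaluates prog (Br (nat_code k) w # args) (es ! k) v"
  "0 < length es \<Longrightarrow> evaluates prog (Br Lf w # args) (switchE es) v \<longleftrightarrow>
     evaluates prog (Br Lf w # args) (es ! 0) v"
  unfolding switchE_def
  by (rule evaluates_branchE; auto simp: evaluates_simps nat_code_simps)+

section \<open>The functions, called by their position in the program\<close>

abbreviation "appendE x y \<equiv> CallE 1 [x, y]"
abbreviation "eqE x y \<equiv> CallE 2 [x, y]"
abbreviation "removeE x y \<equiv> CallE 3 [x, y]"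
abbreviation "tm_varsE x \<equiv> CallE 4 [x]"
abbreviation "fvsE x \<equiv> CallE 5 [x]"
abbreviation "ntempE x y \<equiv> CallE 6 [x, y]"
abbreviation "timesE x \<equiv> CallE 7 [x]"
abbreviation "anchor_tmE x \<equiv> CallE 8 [x]"
abbreviation "anchor_varE x \<equiv> CallE 9 [x]"
abbreviation "flatE x y \<equiv> CallE 10 [x, y]"
abbreviation "defsE x y \<equiv> CallE 11 [x, y]"
abbreviation "stepsE x \<equiv> CallE 12 [x]"
abbreviation "evsE x \<equiv> CallE 13 [x]"
abbreviation "foldr_ExistsE x y \<equiv> CallE 14 [x, y]"

definition append_body :: expr where
  "append_body = IfE (ArgE 0)
     (BrE (HeadE (ArgE 0)) (appendE (TailE (ArgE 0)) (ArgE 1))) (ArgE 1)"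

definition eq_body :: expr where
  "eq_body = IfE (ArgE 0)
     (IfE (ArgE 1) (eqE (TailE (ArgE 0)) (TailE (ArgE 1))) LfE)
     (IfE (ArgE 1) LfE (BrE LfE LfE))"

definition remove_body :: expr where
  "remove_body = IfE (ArgE 1)
     (IfE (eqE (ArgE 0) (HeadE (ArgE 1)))
       (removeE (ArgE 0) (TailE (ArgE 1)))
       (BrE (HeadE (ArgE 1)) (removeE (ArgE 0) (TailE (ArgE 1)))))
     LfE"

definition tm_vars_body :: expr where
  "tm_vars_body = IfE (ArgE 0)
     (IfE (HeadE (HeadE (ArgE 0)))
       (tm_varsE (TailE (ArgE 0)))
       (BrE (HeadE (TailE (HeadE (ArgE 0)))) (tm_varsE (TailE (ArgE 0)))))
     LfE"

definition fvs_body :: expr where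
  "fvs_body = (let un = fvsE sub0; bin = appendE (fvsE sub0) (fvsE sub1);
       quant = removeE sub0 (fvsE sub1)
     in switchE [LfE, LfE, tm_varsE sub1, un, bin, bin, bin, bin, quant, quant,
       un, un, un, bin, bin])"

text \<open>The second argument is an accumulator, so \<open>ntemp A + j\<close>, the first index
  after those of A, is computed without a function for addition.\<close>

definition ntemp_body :: expr where
  "ntemp_body = (let un = ntempE sub0 (ArgE 1); bin = ntempE sub0 (ntempE sub1 (ArgE 1));
       quant = ntempE sub1 (ArgE 1)
     in switchE [ArgE 1, ArgE 1, ArgE 1, un, bin, bin, bin, bin, quant, quant,
       sucE 1 un, sucE 1 un, sucE 1 un, sucE 1 bin, sucE 1 bin])"

definition times_body :: expr where
  "times_body = IfE (ArgE 0) (sucE 4 (timesE (TailE (ArgE 0)))) LfE"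

definition anchor_tm_body :: expr where
  "anchor_tm_body = IfE (fvsE (ArgE 0))
     (nodeE 0 [HeadE (fvsE (ArgE 0))]) (nodeE 1 [LfE])"

definition anchor_var_body :: expr where
  "anchor_var_body = IfE (fvsE (ArgE 0)) (HeadE (fvsE (ArgE 0))) LfE"

definition auxE :: "nat \<Rightarrow> expr \<Rightarrow> expr \<Rightarrow> expr" where
  "auxE r j t = nodeE 2 [sucE r (timesE j), listE [t]]"

text \<open>\<open>HeadE (ArgE 0)\<close> copies the constructor number of the input, so one
  expression serves all Boolean binary connectives. \<open>c\<close> is the code of
  \<open>Const 0\<close>.\<close>

definition flat_body :: expr where
  "flat_body = (let un = flatE sub0 (ArgE 1);
       bin = BrE (HeadE (ArgE 0))
         (listE [flatE sub0 (ArgE 1), flatE sub1 (ntempE sub0 (ArgE 1))]);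
       quant = BrE (HeadE (ArgE 0)) (listE [sub0, flatE sub1 (ArgE 1)]);
       c = nodeE 1 [LfE];
       atom = auxE 0 (ArgE 1) (anchor_tmE (ArgE 0))
     in switchE [ArgE 0, ArgE 0, nodeE 2 [sub0, BrE c (BrE c sub1)],
       nodeE 3 [un], bin, bin, bin, bin, quant, quant,
       auxE 1 (ArgE 1) (anchor_tmE (ArgE 0)), atom, atom, atom, atom])"

definition next_defE :: "expr \<Rightarrow> expr \<Rightarrow> expr \<Rightarrow> expr" where
  "next_defE y j A = nodeE 8 [y, nodeE 7 [auxE 0 j (nodeE 0 [y]), A]]"

definition until_defE :: "expr \<Rightarrow> expr \<Rightarrow> expr \<Rightarrow> expr \<Rightarrow> expr" where
  "until_defE y j A B = (let P = (\<lambda>r. auxE r j (nodeE 0 [y])) in nodeE 8 [y,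
     nodeE 4 [nodeE 7 [P 3, B],
       nodeE 4 [nodeE 7 [P 0, nodeE 5 [P 3, nodeE 4 [A, P 1]]],
                nodeE 7 [P 2, nodeE 6 [P 0, P 3]]]]])"

definition wuntil_defE :: "expr \<Rightarrow> expr \<Rightarrow> expr \<Rightarrow> expr \<Rightarrow> expr" where
  "wuntil_defE y j A B = (let P = (\<lambda>r. auxE r j (nodeE 0 [y])) in nodeE 8 [y,
     nodeE 4 [nodeE 7 [P 3, A],
       nodeE 4 [nodeE 7 [P 0, nodeE 5 [B, nodeE 4 [P 3, P 1]]],
                nodeE 7 [P 2, nodeE 6 [P 3, P 0]]]]])"

definition defs_body :: expr where
  "defs_body = (let y = anchor_varE (ArgE 0); j = ArgE 1; j1 = sucE 1 (ArgE 1);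
       k = ntempE sub0 j; k1 = ntempE sub0 j1;
       un = defsE sub0 j; bin = appendE (defsE sub0 j) (defsE sub1 k); quant = defsE sub1 j;
       bin1 = appendE (defsE sub0 j1) (defsE sub1 k1);
       A = flatE sub0 j1; B = flatE sub1 k1
     in switchE [LfE, LfE, LfE, un, bin, bin, bin, bin, quant, quant,
       BrE (next_defE y j A) (defsE sub0 j1),
       BrE (until_defE y j (nodeE 0 []) A) (defsE sub0 j1),
       BrE (wuntil_defE y j A (nodeE 1 [])) (defsE sub0 j1),
       BrE (until_defE y j A B) bin1,
       BrE (wuntil_defE y j A B) bin1])"

definition steps_body :: expr where
  "steps_body = (let j = timesE (TailE (ArgE 0)) in IfE (ArgE 0)
     (BrE (nodeE 1 [nodeE 0 [sucE 1 j], nodeE 0 [j]])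
       (BrE (nodeE 1 [nodeE 1 [sucE 1 j], nodeE 1 [j]]) (stepsE (TailE (ArgE 0)))))
     LfE)"

definition evs_body :: expr where
  "evs_body = IfE (ArgE 0)
     (BrE (nodeE 1 [nodeE 0 [sucE 2 (timesE (TailE (ArgE 0)))]]) (evsE (TailE (ArgE 0))))
     LfE"

definition foldr_Exists_body :: expr where
  "foldr_Exists_body = IfE (ArgE 0)
     (nodeE 9 [HeadE (ArgE 0), foldr_ExistsE (TailE (ArgE 0)) (ArgE 1)]) (ArgE 1)"

definition main_body :: expr where
  "main_body = (let n = ntempE (ArgE 0) LfE in
     listE [defsE (ArgE 0) LfE, listE [foldr_ExistsE (fvsE (ArgE 0)) (flatE (ArgE 0) LfE)],
       stepsE n, evsE n])"

definition dsnf_prog :: "expr list" where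
  "dsnf_prog = [main_body, append_body, eq_body, remove_body, tm_vars_body, fvs_body, ntemp_body,
     times_body, anchor_tm_body, anchor_var_body, flat_body, defs_body, steps_body, evs_body,
     foldr_Exists_body]"

abbreviation runs :: "expr \<Rightarrow> bt list \<Rightarrow> bt \<Rightarrow> bool" where
  "runs e args v \<equiv> evaluates dsnf_prog args e v"

lemma dsnf_prog_nth:
  "length dsnf_prog = 15"
  "dsnf_prog ! 0 = main_body" "dsnf_prog ! Suc 0 = append_body" "dsnf_prog ! 2 = eq_body"
  "dsnf_prog ! 3 = remove_body" "dsnf_prog ! 4 = tm_vars_body" "dsnf_prog ! 5 = fvs_body"
  "dsnf_prog ! 6 = ntemp_body" "dsnf_prog ! 7 = times_body" "dsnf_prog ! 8 = anchor_tm_body"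
  "dsnf_prog ! 9 = anchor_var_body" "dsnf_prog ! 10 = flat_body" "dsnf_prog ! 11 = defs_body"
  "dsnf_prog ! 12 = steps_body" "dsnf_prog ! 13 = evs_body" "dsnf_prog ! 14 = foldr_Exists_body"
  by (simp_all add: dsnf_prog_def)

lemma evaluates_call:
  "evaluates prog args (CallE i [e]) v \<longleftrightarrow>
     i < length prog \<and> (\<exists>w. evaluates prog args e w \<and> evaluates prog [w] (prog ! i) v)"
  "evaluates prog args (CallE i [e, e']) v \<longleftrightarrow>
     i < length prog \<and> (\<exists>w w'. evaluates prog args e w \<and> evaluates prog args e' w' \<and>
       evaluates prog [w, w'] (prog ! i) v)"
  by (auto simp: evaluates_simps(7) list_all2_Cons1)

lemmas run_simps = evaluates_simps(1-6) evaluates_call evaluates_sucE evaluates_nodeE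
  evaluates_switchE dsnf_prog_nth nat_code_simps sucs_nat_code node_def

section \<open>Correctness of the functions\<close>

lemma runs_append [simp]:
  "runs append_body [list_code vs, list_code ws] v \<longleftrightarrow> v = list_code (vs @ ws)"
  by (induction vs arbitrary: v; subst append_body_def) (auto simp: run_simps)

lemma runs_eq [simp]:
  "runs eq_body [nat_code m, nat_code n] v \<longleftrightarrow> v = (if m = n then Br Lf Lf else Lf)"
proof (induction m arbitrary: n v)
  case 0
  show ?case by (subst eq_body_def, cases n) (auto simp: run_simps)
next
  case (Suc m)
  show ?case by (subst eq_body_def, cases n) (auto simp: run_simps Suc)
qed

text \<open>As in the other recursive functions, \<open>subst\<close> unfolds the body once; the
  recursive call leads to the folded constant again, to which the induction hypothesis
  applies.\<close>

lemma runs_remove [simp]: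
  "runs remove_body [nat_code x, list_code (map nat_code ys)] v \<longleftrightarrow>
     v = list_code (map nat_code (removeAll x ys))"
  by (induction ys arbitrary: v; subst remove_body_def) (auto simp: run_simps)

lemma runs_tm_vars [simp]:
  "runs tm_vars_body [list_code (map tm_code ts)] v \<longleftrightarrow> v = list_code (map nat_code (tm_vars ts))"
  by (induction ts arbitrary: v rule: tm_vars.induct; subst tm_vars_body_def) (auto simp: run_simps)

lemma runs_fvs [simp]:
  "runs fvs_body [fm_code A] v \<longleftrightarrow> v = list_code (map nat_code (fvs A))"
  by (induction A arbitrary: v; subst fvs_body_def) (simp_all add: run_simps Let_def)

lemma runs_ntemp [simp]:
  "runs ntemp_body [fm_code A, nat_code j] v \<longleftrightarrow> v = nat_code (ntemp A + j)"
  by (induction A arbitrary: j v; subst ntemp_body_def)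
    (simp_all add: run_simps Let_def add.assoc)

lemma runs_times [simp]: "runs times_body [nat_code j] v \<longleftrightarrow> v = nat_code (4 * j)"
  by (induction j arbitrary: v; subst times_body_def) (simp_all add: run_simps add.commute)

lemma runs_anchor_tm [simp]: "runs anchor_tm_body [fm_code A] v \<longleftrightarrow> v = tm_code (anchor_tm A)"
  by (cases "fvs A") (simp_all add: anchor_tm_body_def anchor_tm_def run_simps)

lemma runs_anchor_var [simp]: "runs anchor_var_body [fm_code A] v \<longleftrightarrow> v = nat_code (anchor_var A)"
  by (cases "fvs A") (simp_all add: anchor_var_body_def anchor_var_def run_simps)

text \<open>
  The simplifier unfolds the code of a compound formula, so \<open>runs_anchor_tm\<close> and
  \<open>runs_anchor_var\<close> no longer match there.
\<close>

lemmas runs_anchor_simps =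
  runs_anchor_tm[of "Next A", unfolded fm_code.simps node_def list_code.simps]
  runs_anchor_tm[of "Sometime A", unfolded fm_code.simps node_def list_code.simps]
  runs_anchor_tm[of "Always A", unfolded fm_code.simps node_def list_code.simps]
  runs_anchor_tm[of "Until A B", unfolded fm_code.simps node_def list_code.simps]
  runs_anchor_tm[of "WUntil A B", unfolded fm_code.simps node_def list_code.simps]
  runs_anchor_var[of "Next A", unfolded fm_code.simps node_def list_code.simps]
  runs_anchor_var[of "Sometime A", unfolded fm_code.simps node_def list_code.simps]
  runs_anchor_var[of "Always A", unfolded fm_code.simps node_def list_code.simps]
  runs_anchor_var[of "Until A B", unfolded fm_code.simps node_def list_code.simps]
  runs_anchor_var[of "WUntil A B", unfolded fm_code.simps node_def list_code.simps]
  for A B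

lemma runs_flat [simp]:
  "runs flat_body [fm_code A, nat_code j] v \<longleftrightarrow> v = fm_code (flat A j)"
  by (induction A arbitrary: j v; subst flat_body_def)
    (simp_all add: run_simps runs_anchor_simps Let_def aux_def auxE_def)

lemma runs_defs [simp]:
  "runs defs_body [fm_code A, nat_code j] v \<longleftrightarrow> v = list_code (map fm_code (defs A j))"
  by (induction A arbitrary: j v; subst defs_body_def)
    (simp_all add: run_simps runs_anchor_simps Let_def aux_def auxE_def
      next_def_def until_def_def wuntil_def_def next_defE_def until_defE_def wuntil_defE_def)

lemma runs_steps [simp]:
  "runs steps_body [nat_code n] v \<longleftrightarrow> v = list_code (map step_code (steps n))"
  by (induction n arbitrary: v; subst steps_body_def) (simp_all add: run_simps Let_def)

lemma runs_evs [simp]: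
  "runs evs_body [nat_code n] v \<longleftrightarrow> v = list_code (map ev_code (evs n))"
  by (induction n arbitrary: v; subst evs_body_def) (simp_all add: run_simps)

lemma runs_foldr_Exists [simp]:
  "runs foldr_Exists_body [list_code (map nat_code xs), fm_code A] v \<longleftrightarrow>
     v = fm_code (foldr Exists xs A)"
  by (induction xs arbitrary: v; subst foldr_Exists_body_def) (simp_all add: run_simps)

lemma runs_main: "runs main_body [fm_code A] (problem_code (to_dsnf A))"
proof -
  show ?thesis
    using runs_ntemp[of A 0] runs_defs[of A 0] runs_flat[of A 0]
    by (simp add: main_body_def run_simps Let_def problem_code_def to_dsnf_def)
qed

lemma effective_to_dsnf: "effective_on X fm_code problem_code to_dsnf"
  unfolding effective_on_def
  by (rule exI[of _ dsnf_prog]) (simp add: run_simps runs_main)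

theorem theorem1:
  shows "\<exists>(f :: fm \<Rightarrow> problem) (c :: nat).
    effective_on {\<phi>. monodic \<phi>} fm_code problem_code f \<and>
    (\<forall>\<phi>. monodic \<phi> \<longrightarrow>
      dsnf (f \<phi>) \<and>
      (satisfiable \<phi> \<longleftrightarrow> satisfiable (problem_fm (f \<phi>))) \<and>
      fm_size (problem_fm (f \<phi>)) \<le> c * fm_size \<phi>)"
  by (intro exI[of _ to_dsnf] exI[of _ 100] conjI allI impI effective_to_dsnf dsnf_to_dsnf
      satisfiable_to_dsnf fm_size_to_dsnf)

end
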